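(* Let $T$ be NIP, let $M'\models T$ and let $M\prec M'$ be an elementary submodel. Let $\mu$ be an $L$-measure over $M'$ in variable $x$, finitely satisfiable in $M$. Assume that the $\Delta$-measure $\tilde\mu$ over $M'$ defined by setting $\tilde\mu(P(x))=1$ and $\tilde\mu_{|L}=\mu$ is smooth (over $M'$). Then $\mu$ is smooth over $M$.
   Context: $L$ is a first-order language, $T$ a complete $L$-theory, $\mathcal U$ a monster model (a big saturated model) of $T$, and $M\prec M'\prec\mathcal U$ are small. An $L$-measure (Keisler measure) over $A$ in variable $x$ is a finitely additive probability measure on the Boolean algebra of $L(A)$-formulas in $x$ modulo equivalence; it is global if $A=\mathcal U$. An $L$-measure $\mu$ over $M'$ is finitely satisfiable in $M$ if every $\phi(x)\in L(M')$ with $\mu(\phi(x))>0$ is satisfied by a tuple of $M$. An $L$-measure over $M'$ is smooth over $M\prec M'$ if its restriction to $L(M)$-formulas has a unique extension to a global $L$-measure. $L_P=L\cup\{P\}$ with $P$ a new unary predicate; $(M',M)$ is the $L_P$-structure expanding $M'$ with $P$ interpreted by $M$. For a tuple $x=x_1\dots x_n$, $P(x)=P(x_1)\wedge\dots\wedge P(x_n)$. $\Delta$ is the Boolean algebra generated by $L$-formulas and $P(x)$; $\Delta(A)$ is the set of formulas of $\Delta$ in variable $x$ with parameters in $A$, so each formula in $\Delta(M')$ has the form $(\psi(x)\wedge P(x))\vee(\chi(x)\wedge\neg P(x))$ with $\psi,\chi\in L(M')$. A $\Delta$-measure over $A$ is a finitely additive probability measure on $\Delta(A)$ (modulo equivalence).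 Since $\mu$ is finitely satisfiable in $M$, the measure $\tilde\mu$ above is well defined, with $\tilde\mu((\psi\wedge P)\vee(\chi\wedge\neg P))=\mu(\psi)$. The monster $\mathcal U$ is expanded (by saturation) to an $L_P$-structure $(\mathcal U,P(\mathcal U))\succ(M',M)$ (itself a monster model), and $\tilde\mu$ is smooth over $M'$ if it has a unique extension to a $\Delta$-measure over $\mathcal U$. *)

theory Defs
  imports Complex_Main
begin

unbundle cardinal_syntax

section \<open>First-order logic\<close>

text \<open>
  A symbol of arity k is a pair of a name and k; one name may carry several arities.
\<close>

record ('f, 'r) lang =
  Funs :: "('f \<times> nat) set"
  Rels :: "('r \<times> nat) set"

record ('a, 'f, 'r) struct =
  univ :: "'a set"
  fn :: "'f \<Rightarrow> 'a list \<Rightarrow> 'a"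
  rel :: "'r \<Rightarrow> 'a list \<Rightarrow> bool"

definition is_structure :: "('f, 'r) lang \<Rightarrow> ('a, 'f, 'r) struct \<Rightarrow> bool" where
  "is_structure L N \<longleftrightarrow> univ N \<noteq> {} \<and>
     (\<forall>(f, k) \<in> Funs L. \<forall>as. length as = k \<and> set as \<subseteq> univ N \<longrightarrow> fn N f as \<in> univ N)"

text \<open>
  \<open>Cst a\<close> is a parameter: an element of a structure, used as a constant naming itself.
\<close>

datatype ('f, 'a) trm = Var nat | Cst 'a | Fun 'f "('f, 'a) trm list"

datatype ('f, 'r, 'a) fm =
    Tru
  | Eq "('f, 'a) trm" "('f, 'a) trm"
  | Rel 'r "('f, 'a) trm list"
  | Neg "('f, 'r, 'a) fm"
  | Conj "('f, 'r, 'a) fm" "('f, 'r, 'a) fm"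
  | Ex nat "('f, 'r, 'a) fm"

abbreviation Disj :: "('f, 'r, 'a) fm \<Rightarrow> ('f, 'r, 'a) fm \<Rightarrow> ('f, 'r, 'a) fm" where
  "Disj \<phi> \<psi> \<equiv> Neg (Conj (Neg \<phi>) (Neg \<psi>))"

primrec trm_ok :: "('f, 'r) lang \<Rightarrow> 'a set \<Rightarrow> ('f, 'a) trm \<Rightarrow> bool" where
  "trm_ok L A (Var i) \<longleftrightarrow> True"
| "trm_ok L A (Cst a) \<longleftrightarrow> a \<in> A"
| "trm_ok L A (Fun f ts) \<longleftrightarrow> (f, length ts) \<in> Funs L \<and> list_all (trm_ok L A) ts"

primrec fm_ok :: "('f, 'r) lang \<Rightarrow> 'a set \<Rightarrow> ('f, 'r, 'a) fm \<Rightarrow> bool" where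
  "fm_ok L A Tru \<longleftrightarrow> True"
| "fm_ok L A (Eq s t) \<longleftrightarrow> trm_ok L A s \<and> trm_ok L A t"
| "fm_ok L A (Rel r ts) \<longleftrightarrow> (r, length ts) \<in> Rels L \<and> list_all (trm_ok L A) ts"
| "fm_ok L A (Neg \<phi>) \<longleftrightarrow> fm_ok L A \<phi>"
| "fm_ok L A (Conj \<phi> \<psi>) \<longleftrightarrow> fm_ok L A \<phi> \<and> fm_ok L A \<psi>"
| "fm_ok L A (Ex i \<phi>) \<longleftrightarrow> fm_ok L A \<phi>"

primrec fv_trm :: "('f, 'a) trm \<Rightarrow> nat set" where
  "fv_trm (Var i) = {i}"
| "fv_trm (Cst a) = {}"
| "fv_trm (Fun f ts) = \<Union> (set (map fv_trm ts))"

primrec fv :: "('f, 'r, 'a) fm \<Rightarrow> nat set" where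
  "fv Tru = {}"
| "fv (Eq s t) = fv_trm s \<union> fv_trm t"
| "fv (Rel r ts) = \<Union> (set (map fv_trm ts))"
| "fv (Neg \<phi>) = fv \<phi>"
| "fv (Conj \<phi> \<psi>) = fv \<phi> \<union> fv \<psi>"
| "fv (Ex i \<phi>) = fv \<phi> - {i}"

text \<open>
  The \<open>L(A)\<close>-formulas in the tuple of variables \<open>x = (Var 0, \<dots>, Var (n - 1))\<close>.
  In particular \<open>formulas L 0 A\<close> are the \<open>L(A)\<close>-sentences.
\<close>

definition formulas :: "('f, 'r) lang \<Rightarrow> nat \<Rightarrow> 'a set \<Rightarrow> ('f, 'r, 'a) fm set" where
  "formulas L n A = {\<phi>. fm_ok L A \<phi> \<and> fv \<phi> \<subseteq> {..<n}}"

primrec trm_val :: "('a, 'f, 'r) struct \<Rightarrow> (nat \<Rightarrow> 'a) \<Rightarrow> ('f, 'a) trm \<Rightarrow> 'a" where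
  "trm_val N e (Var i) = e i"
| "trm_val N e (Cst a) = a"
| "trm_val N e (Fun f ts) = fn N f (map (trm_val N e) ts)"

primrec sat :: "('a, 'f, 'r) struct \<Rightarrow> (nat \<Rightarrow> 'a) \<Rightarrow> ('f, 'r, 'a) fm \<Rightarrow> bool" where
  "sat N e Tru \<longleftrightarrow> True"
| "sat N e (Eq s t) \<longleftrightarrow> trm_val N e s = trm_val N e t"
| "sat N e (Rel r ts) \<longleftrightarrow> rel N r (map (trm_val N e) ts)"
| "sat N e (Neg \<phi>) \<longleftrightarrow> \<not> sat N e \<phi>"
| "sat N e (Conj \<phi> \<psi>) \<longleftrightarrow> sat N e \<phi> \<and> sat N e \<psi>"
| "sat N e (Ex i \<phi>) \<longleftrightarrow> (\<exists>a \<in> univ N. sat N (e(i := a)) \<phi>)"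

definition tuples :: "'a set \<Rightarrow> nat \<Rightarrow> 'a list set" where
  "tuples A n = {as. length as = n \<and> set as \<subseteq> A}"

text \<open>
  \<open>holds N \<phi> as\<close> is \<open>N \<Turnstile> \<phi>(as)\<close>; it is only used when the free variables of \<open>\<phi>\<close> are below
  \<open>length as\<close>, so that the value of \<open>nth as\<close> beyond the length of \<open>as\<close> is irrelevant.
\<close>

definition holds :: "('a, 'f, 'r) struct \<Rightarrow> ('f, 'r, 'a) fm \<Rightarrow> 'a list \<Rightarrow> bool" where
  "holds N \<phi> as \<longleftrightarrow> sat N (nth as) \<phi>"

definition solutions :: "('a, 'f, 'r) struct \<Rightarrow> nat \<Rightarrow> ('f, 'r, 'a) fm \<Rightarrow> 'a list set" where
  "solutions N n \<phi> = {as \<in> tuples (univ N) n. holds N \<phi> as}"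

definition elementary_sub ::
    "('f, 'r) lang \<Rightarrow> ('a, 'f, 'r) struct \<Rightarrow> ('a, 'f, 'r) struct \<Rightarrow> bool" where
  "elementary_sub L M N \<longleftrightarrow> is_structure L M \<and> is_structure L N \<and> univ M \<subseteq> univ N \<and>
     (\<forall>\<sigma> \<in> formulas L 0 (univ M). holds M \<sigma> [] \<longleftrightarrow> holds N \<sigma> [])"


section \<open>Complete theories, NIP, monster models\<close>

definition is_model ::
    "('f, 'r) lang \<Rightarrow> ('f, 'r, 'a) fm set \<Rightarrow> ('a, 'f, 'r) struct \<Rightarrow> bool" where
  "is_model L T N \<longleftrightarrow> is_structure L N \<and> (\<forall>\<sigma> \<in> T. holds N \<sigma> [])"

text \<open>
  HOL cannot quantify over all types inside a definition, so here and in \<open>NIP\<close> the models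
  of T range over the structures with universe contained in the type \<open>'a\<close>.  When \<open>'a\<close>
  is infinite and at least as large as the language, this makes no difference for
  completeness, by the Loewenheim-Skolem theorem.
\<close>

definition entails ::
    "('f, 'r) lang \<Rightarrow> ('f, 'r, 'a) fm set \<Rightarrow> ('f, 'r, 'a) fm \<Rightarrow> bool" where
  "entails L T \<sigma> \<longleftrightarrow> (\<forall>N :: ('a, 'f, 'r) struct. is_model L T N \<longrightarrow> holds N \<sigma> [])"

definition complete_theory :: "('f, 'r) lang \<Rightarrow> ('f, 'r, 'a) fm set \<Rightarrow> bool" where
  "complete_theory L T \<longleftrightarrow> T \<subseteq> formulas L 0 {} \<and> (\<exists>N :: ('a, 'f, 'r) struct. is_model L T N) \<and>
     (\<forall>\<sigma> \<in> formulas L 0 {}. entails L T \<sigma> \<or> entails L T (Neg \<sigma>))"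

text \<open>
  The variables of \<open>\<phi>(x; y)\<close> are split as \<open>x = (Var 0, \<dots>, Var (n - 1))\<close> and
  \<open>y = (Var n, \<dots>, Var (n + m - 1))\<close>.
\<close>

definition shattered ::
    "('a, 'f, 'r) struct \<Rightarrow> ('f, 'r, 'a) fm \<Rightarrow> nat \<Rightarrow> 'a list set \<Rightarrow> bool" where
  "shattered N \<phi> m X \<longleftrightarrow>
     (\<forall>I \<subseteq> X. \<exists>b \<in> tuples (univ N) m. \<forall>a \<in> X. holds N \<phi> (a @ b) \<longleftrightarrow> a \<in> I)"

text \<open>
  No formula shatters an infinite set of tuples in a model of T.  (For complete T it is
  equivalent to ask this of a single \<open>\<aleph>\<^sub>1\<close>-saturated model, such as a monster model.)
\<close>

definition NIP :: "('f, 'r) lang \<Rightarrow> ('f, 'r, 'a) fm set \<Rightarrow> bool" where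
  "NIP L T \<longleftrightarrow>
     (\<forall>n m. \<forall>\<phi> \<in> formulas L (n + m) {}. \<forall>N :: ('a, 'f, 'r) struct. is_model L T N \<longrightarrow>
        \<not> (\<exists>X \<subseteq> tuples (univ N) n. infinite X \<and> shattered N \<phi> m X))"

definition saturated :: "'k rel \<Rightarrow> ('f, 'r) lang \<Rightarrow> ('a, 'f, 'r) struct \<Rightarrow> bool" where
  "saturated \<kappa> L N \<longleftrightarrow>
     (\<forall>A n p. A \<subseteq> univ N \<and> |A| <o \<kappa> \<and> p \<subseteq> formulas L n A \<and>
        (\<forall>q \<subseteq> p. finite q \<longrightarrow> (\<exists>as \<in> tuples (univ N) n. \<forall>\<phi> \<in> q. holds N \<phi> as)) \<longrightarrow>
        (\<exists>as \<in> tuples (univ N) n. \<forall>\<phi> \<in> p. holds N \<phi> as))"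

text \<open>
  A monster model is \<open>\<kappa>\<close>-saturated for a cardinal \<open>\<kappa>\<close> (a cardinal order) that is big compared
  to the language; small means of cardinality below \<open>\<kappa>\<close>.  For \<open>\<kappa> = |univ N|\<close> this is a
  big saturated model in the strict sense.
\<close>

definition monster :: "'k rel \<Rightarrow> ('f, 'r) lang \<Rightarrow> ('a, 'f, 'r) struct \<Rightarrow> bool" where
  "monster \<kappa> L N \<longleftrightarrow> Card_order \<kappa> \<and> natLeq <o \<kappa> \<and> |Funs L| <o \<kappa> \<and> |Rels L| <o \<kappa> \<and>
     is_structure L N \<and> saturated \<kappa> L N"


section \<open>Pairs of models\<close>

text \<open>The new unary predicate P is the relation symbol \<open>None\<close>.\<close>

definition add_pred :: "('f, 'r) lang \<Rightarrow> ('f, 'r option) lang" where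
  "add_pred L = \<lparr>Funs = Funs L, Rels = insert (None, 1) ((\<lambda>(r, k). (Some r, k)) ` Rels L)\<rparr>"

definition pair :: "('a, 'f, 'r) struct \<Rightarrow> 'a set \<Rightarrow> ('a, 'f, 'r option) struct" where
  "pair N P = \<lparr>univ = univ N, fn = fn N,
     rel = (\<lambda>s as. case s of None \<Rightarrow> (\<exists>a \<in> P. as = [a]) | Some r \<Rightarrow> rel N r as)\<rparr>"

definition lift :: "('f, 'r, 'a) fm \<Rightarrow> ('f, 'r option, 'a) fm" where
  "lift = map_fm (\<lambda>f. f) Some (\<lambda>a. a)"

text \<open>\<open>P_all n\<close> is \<open>P(x) = P(x\<^sub>1) \<and> \<dots> \<and> P(x\<^sub>n)\<close>.\<close>

primrec P_all :: "nat \<Rightarrow> ('f, 'r option, 'a) fm" where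
  "P_all 0 = Tru"
| "P_all (Suc n) = Conj (P_all n) (Rel None [Var n])"

inductive_set Delta :: "('f, 'r) lang \<Rightarrow> nat \<Rightarrow> 'a set \<Rightarrow> ('f, 'r option, 'a) fm set"
  for L :: "('f, 'r) lang" and n :: nat and A :: "'a set" where
  "\<phi> \<in> formulas L n A \<Longrightarrow> lift \<phi> \<in> Delta L n A"
| "P_all n \<in> Delta L n A"
| "\<theta> \<in> Delta L n A \<Longrightarrow> Neg \<theta> \<in> Delta L n A"
| "\<theta> \<in> Delta L n A \<Longrightarrow> \<eta> \<in> Delta L n A \<Longrightarrow> Conj \<theta> \<eta> \<in> Delta L n A"


section \<open>Keisler measures\<close>

text \<open>
  \<open>fa_measure N n F \<mu>\<close>: \<open>\<mu>\<close> is a finitely additive probability measure on the Boolean algebra of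
  the formulas in F (in n variables) modulo equivalence in N.  Values of \<open>\<mu>\<close> outside F are
  irrelevant, so measures on F are to be compared on F only.
\<close>

definition fa_measure :: "('a, 'f, 'r) struct \<Rightarrow> nat \<Rightarrow> ('f, 'r, 'a) fm set \<Rightarrow>
    (('f, 'r, 'a) fm \<Rightarrow> real) \<Rightarrow> bool" where
  "fa_measure N n F \<mu> \<longleftrightarrow>
     (\<forall>\<phi> \<in> F. \<forall>\<psi> \<in> F. solutions N n \<phi> = solutions N n \<psi> \<longrightarrow> \<mu> \<phi> = \<mu> \<psi>) \<and>
     (\<forall>\<phi> \<in> F. 0 \<le> \<mu> \<phi>) \<and>
     \<mu> Tru = 1 \<and>
     (\<forall>\<phi> \<in> F. \<forall>\<psi> \<in> F. solutions N n \<phi> \<inter> solutions N n \<psi> = {} \<longrightarrow>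
        \<mu> (Disj \<phi> \<psi>) = \<mu> \<phi> + \<mu> \<psi>)"

definition unique_extension :: "('a, 'f, 'r) struct \<Rightarrow> nat \<Rightarrow> ('f, 'r, 'a) fm set \<Rightarrow>
    ('f, 'r, 'a) fm set \<Rightarrow> (('f, 'r, 'a) fm \<Rightarrow> real) \<Rightarrow> bool" where
  "unique_extension N n F G \<mu> \<longleftrightarrow>
     (\<exists>\<nu>. fa_measure N n G \<nu> \<and> (\<forall>\<phi> \<in> F. \<nu> \<phi> = \<mu> \<phi>)) \<and>
     (\<forall>\<nu> \<nu>'. fa_measure N n G \<nu> \<and> (\<forall>\<phi> \<in> F. \<nu> \<phi> = \<mu> \<phi>) \<and>
             fa_measure N n G \<nu>' \<and> (\<forall>\<phi> \<in> F. \<nu>' \<phi> = \<mu> \<phi>) \<longrightarrow> (\<forall>\<phi> \<in> G. \<nu> \<phi> = \<nu>' \<phi>))"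

text \<open>
  In the following U is the monster model, in which equivalence of formulas and satisfaction
  are evaluated; A is the set of parameters.
\<close>

definition L_measure :: "('f, 'r) lang \<Rightarrow> ('a, 'f, 'r) struct \<Rightarrow> nat \<Rightarrow> 'a set \<Rightarrow>
    (('f, 'r, 'a) fm \<Rightarrow> real) \<Rightarrow> bool" where
  "L_measure L U n A \<mu> \<longleftrightarrow> fa_measure U n (formulas L n A) \<mu>"

definition fin_satisfiable :: "('f, 'r) lang \<Rightarrow> ('a, 'f, 'r) struct \<Rightarrow> nat \<Rightarrow> 'a set \<Rightarrow>
    (('f, 'r, 'a) fm \<Rightarrow> real) \<Rightarrow> 'a set \<Rightarrow> bool" where
  "fin_satisfiable L U n A \<mu> B \<longleftrightarrow>
     (\<forall>\<phi> \<in> formulas L n A. 0 < \<mu> \<phi> \<longrightarrow> (\<exists>as \<in> tuples B n. holds U \<phi> as))"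

definition L_smooth :: "('f, 'r) lang \<Rightarrow> ('a, 'f, 'r) struct \<Rightarrow> nat \<Rightarrow> 'a set \<Rightarrow>
    (('f, 'r, 'a) fm \<Rightarrow> real) \<Rightarrow> bool" where
  "L_smooth L U n B \<mu> \<longleftrightarrow> unique_extension U n (formulas L n B) (formulas L n (univ U)) \<mu>"

definition Delta_measure :: "('f, 'r) lang \<Rightarrow> ('a, 'f, 'r) struct \<Rightarrow> 'a set \<Rightarrow> nat \<Rightarrow> 'a set \<Rightarrow>
    (('f, 'r option, 'a) fm \<Rightarrow> real) \<Rightarrow> bool" where
  "Delta_measure L U PU n A \<mu> \<longleftrightarrow> fa_measure (pair U PU) n (Delta L n A) \<mu>"

definition Delta_smooth :: "('f, 'r) lang \<Rightarrow> ('a, 'f, 'r) struct \<Rightarrow> 'a set \<Rightarrow> nat \<Rightarrow> 'a set \<Rightarrow>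
    (('f, 'r option, 'a) fm \<Rightarrow> real) \<Rightarrow> bool" where
  "Delta_smooth L U PU n B \<mu> \<longleftrightarrow>
     unique_extension (pair U PU) n (Delta L n B) (Delta L n (univ U)) \<mu>"

definition is_tilde :: "('f, 'r) lang \<Rightarrow> ('a, 'f, 'r) struct \<Rightarrow> 'a set \<Rightarrow> nat \<Rightarrow> 'a set \<Rightarrow>
    (('f, 'r, 'a) fm \<Rightarrow> real) \<Rightarrow> (('f, 'r option, 'a) fm \<Rightarrow> real) \<Rightarrow> bool" where
  "is_tilde L U PU n A \<mu> \<mu>' \<longleftrightarrow> Delta_measure L U PU n A \<mu>' \<and> \<mu>' (P_all n) = 1 \<and>
     (\<forall>\<phi> \<in> formulas L n A. \<mu>' (lift \<phi>) = \<mu> \<phi>)"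

text \<open>
  The conditions in \<open>is_tilde\<close> determine the measure on \<open>\<Delta>(A)\<close>
  (\<open>is_tilde_unique\<close>, \<open>is_tilde_formula\<close>), and such a measure exists when \<open>\<mu>\<close> is finitely
  satisfiable in a subset of P (\<open>is_tilde_exists\<close>).
\<close>

lemma solutions_simps [simp]:
  "solutions N n Tru = tuples (univ N) n"
  "solutions N n (Neg \<phi>) = tuples (univ N) n - solutions N n \<phi>"
  "solutions N n (Conj \<phi> \<psi>) = solutions N n \<phi> \<inter> solutions N n \<psi>"
  by (auto simp: solutions_def holds_def)

lemma solutions_subset: "solutions N n \<phi> \<subseteq> tuples (univ N) n"
  by (auto simp: solutions_def)

lemma trm_val_pair [simp]: "trm_val (pair N P) e t = trm_val N e t"
proof (induction t)
  case (Fun f ts)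
  then show ?case by (simp add: pair_def cong: map_cong)
qed simp_all

lemma sat_lift [simp]: "sat (pair N P) e (lift \<phi>) = sat N e \<phi>"
proof (induction \<phi> arbitrary: e)
  case (Rel r ts)
  have "rel (pair N P) (Some r) as = rel N r as" for as
    by (simp add: pair_def)
  then show ?case
    by (simp add: lift_def trm.map_ident comp_def)
qed (simp_all add: lift_def trm.map_ident, simp_all add: pair_def)

lemma univ_pair [simp]: "univ (pair N P) = univ N"
  by (simp add: pair_def)

lemma solutions_lift [simp]: "solutions (pair N P) n (lift \<phi>) = solutions N n \<phi>"
  by (simp add: solutions_def holds_def)

lemma sat_P_all: "sat (pair N P) e (P_all n) \<longleftrightarrow> (\<forall>i<n. e i \<in> P)"
  by (induction n) (auto simp: pair_def less_Suc_eq)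

lemma solutions_P_all:
  assumes "P \<subseteq> univ N"
  shows "solutions (pair N P) n (P_all n) = tuples P n"
  using assms by (auto simp: solutions_def holds_def sat_P_all tuples_def set_conv_nth)

definition bool_closed :: "('f, 'r, 'a) fm set \<Rightarrow> bool" where
  "bool_closed F \<longleftrightarrow> Tru \<in> F \<and> (\<forall>\<phi> \<in> F. Neg \<phi> \<in> F) \<and> (\<forall>\<phi> \<in> F. \<forall>\<psi> \<in> F. Conj \<phi> \<psi> \<in> F)"

lemma bool_closed_formulas: "bool_closed (formulas L n A)"
  by (auto simp: bool_closed_def formulas_def)

lemma bool_closed_Delta: "bool_closed (Delta L n A)"
proof -
  have "lift Tru \<in> Delta L n A"
    by (rule Delta.intros) (simp add: formulas_def)
  then show ?thesis
    by (auto simp: bool_closed_def lift_def intro: Delta.intros)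
qed

lemma fa_measure_split:
  assumes "fa_measure N n F \<mu>" "bool_closed F" "\<phi> \<in> F" "\<psi> \<in> F"
  shows "\<mu> \<phi> = \<mu> (Conj \<phi> \<psi>) + \<mu> (Conj \<phi> (Neg \<psi>))"
proof -
  let ?a = "Conj \<phi> \<psi>" and ?b = "Conj \<phi> (Neg \<psi>)"
  have F: "?a \<in> F" "?b \<in> F" "Disj ?a ?b \<in> F"
    using assms by (auto simp: bool_closed_def)
  have "solutions N n (Disj ?a ?b) = solutions N n \<phi>"
    using solutions_subset[of N n \<phi>] by auto
  then have "\<mu> \<phi> = \<mu> (Disj ?a ?b)"
    using assms F unfolding fa_measure_def by metis
  moreover have "solutions N n ?a \<inter> solutions N n ?b = {}" by auto
  ultimately show ?thesis
    using assms F unfolding fa_measure_def by metis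
qed

lemma fa_measure_eqI:
  assumes "fa_measure N n F \<mu>" "bool_closed F" "\<phi> \<in> F" "\<psi> \<in> F"
    and "\<mu> (Conj \<phi> (Neg \<psi>)) = 0" "\<mu> (Conj \<psi> (Neg \<phi>)) = 0"
  shows "\<mu> \<phi> = \<mu> \<psi>"
proof -
  have "solutions N n (Conj \<phi> \<psi>) = solutions N n (Conj \<psi> \<phi>)" by auto
  moreover have "Conj \<phi> \<psi> \<in> F" "Conj \<psi> \<phi> \<in> F"
    using assms by (auto simp: bool_closed_def)
  ultimately have "\<mu> (Conj \<phi> \<psi>) = \<mu> (Conj \<psi> \<phi>)"
    using assms(1) unfolding fa_measure_def by metis
  then show ?thesis
    using fa_measure_split[OF assms(1-4)] fa_measure_split[OF assms(1,2,4,3)] assms(5,6) by simp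
qed

lemma fa_measure_zero:
  assumes "fa_measure N n F \<mu>" "bool_closed F" "\<phi> \<in> F" "\<psi> \<in> F"
    and "\<mu> \<psi> = 1" "solutions N n \<phi> \<inter> solutions N n \<psi> = {}"
  shows "\<mu> \<phi> = 0"
proof -
  have F: "Tru \<in> F" "Neg \<psi> \<in> F" "Conj Tru \<psi> \<in> F" "Conj Tru (Neg \<psi>) \<in> F"
      "Conj (Neg \<psi>) \<phi> \<in> F" "Conj (Neg \<psi>) (Neg \<phi>) \<in> F"
    using assms(2-4) by (auto simp: bool_closed_def)
  have cong: "\<mu> \<alpha> = \<mu> \<beta>" if "\<alpha> \<in> F" "\<beta> \<in> F" "solutions N n \<alpha> = solutions N n \<beta>" for \<alpha> \<beta>
    using assms(1) that unfolding fa_measure_def by metis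
  have nonneg: "0 \<le> \<mu> \<alpha>" if "\<alpha> \<in> F" for \<alpha>
    using assms(1) that unfolding fa_measure_def by metis
  have "\<mu> (Conj Tru \<psi>) = \<mu> \<psi>" "\<mu> (Conj Tru (Neg \<psi>)) = \<mu> (Neg \<psi>)"
    by (rule cong; use F assms(4) solutions_subset[of N n \<psi>] in auto)+
  moreover have "\<mu> Tru = 1"
    using assms(1) by (simp add: fa_measure_def)
  ultimately have "\<mu> (Neg \<psi>) = 0"
    using fa_measure_split[OF assms(1,2) F(1) assms(4)] assms(5) by simp
  moreover have "\<mu> (Conj (Neg \<psi>) \<phi>) = \<mu> \<phi>"
    by (rule cong) (use F assms(3,6) solutions_subset[of N n \<phi>] in auto)
  ultimately show ?thesis
    using fa_measure_split[OF assms(1,2) F(2) assms(3)] nonneg[OF assms(3)] nonneg[OF F(6)] by simp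
qed

lemma Delta_on_P:
  assumes "\<theta> \<in> Delta L n A" "P \<subseteq> univ N"
  shows "\<exists>\<psi> \<in> formulas L n A.
    solutions (pair N P) n \<theta> \<inter> tuples P n = solutions N n \<psi> \<inter> tuples P n"
  using assms(1)
proof induction
  case (1 \<phi>)
  then show ?case by auto
next
  case 2
  have "solutions (pair N P) n (P_all n) \<inter> tuples P n = solutions N n Tru \<inter> tuples P n"
    using assms(2) by (auto simp: solutions_P_all tuples_def)
  moreover have "Tru \<in> formulas L n A"
    by (simp add: formulas_def)
  ultimately show ?case by blast
next
  case (3 \<theta>)
  then obtain \<psi> where "\<psi> \<in> formulas L n A"
    "solutions (pair N P) n \<theta> \<inter> tuples P n = solutions N n \<psi> \<inter> tuples P n" by blast
  then show ?case
    by (intro bexI[of _ "Neg \<psi>"]) (auto simp: formulas_def)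
next
  case (4 \<theta> \<eta>)
  then obtain \<psi> \<chi> where "\<psi> \<in> formulas L n A" "\<chi> \<in> formulas L n A"
    "solutions (pair N P) n \<theta> \<inter> tuples P n = solutions N n \<psi> \<inter> tuples P n"
    "solutions (pair N P) n \<eta> \<inter> tuples P n = solutions N n \<chi> \<inter> tuples P n" by blast
  then show ?case
    by (intro bexI[of _ "Conj \<psi> \<chi>"]) (auto simp: formulas_def)
qed

lemma is_tilde_eq:
  assumes "is_tilde L U PU n A \<mu> \<mu>'" "PU \<subseteq> univ U" "\<theta> \<in> Delta L n A" "\<psi> \<in> formulas L n A"
    and "solutions (pair U PU) n \<theta> \<inter> tuples PU n = solutions U n \<psi> \<inter> tuples PU n"
  shows "\<mu>' \<theta> = \<mu> \<psi>"
proof -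
  let ?F = "Delta L n A"
  have m: "fa_measure (pair U PU) n ?F \<mu>'" and P: "\<mu>' (P_all n) = 1"
    and ext: "\<mu>' (lift \<psi>) = \<mu> \<psi>"
    using assms by (auto simp: is_tilde_def Delta_measure_def)
  have F: "lift \<psi> \<in> ?F" "P_all n \<in> ?F"
    using assms by (auto intro: Delta.intros)
  have "\<mu>' (Conj \<theta> (Neg (lift \<psi>))) = 0"
    by (rule fa_measure_zero[OF m bool_closed_Delta _ F(2) P])
      (use F assms in \<open>auto simp: solutions_P_all intro!: Delta.intros(3,4)\<close>)
  moreover have "\<mu>' (Conj (lift \<psi>) (Neg \<theta>)) = 0"
    by (rule fa_measure_zero[OF m bool_closed_Delta _ F(2) P])
      (use F assms in \<open>auto simp: solutions_P_all intro!: Delta.intros(3,4)\<close>)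
  ultimately have "\<mu>' \<theta> = \<mu>' (lift \<psi>)"
    using fa_measure_eqI[OF m bool_closed_Delta assms(3) F(1)] by simp
  then show ?thesis using ext by simp
qed

lemma is_tilde_unique:
  assumes "is_tilde L U PU n A \<mu> \<mu>1" "is_tilde L U PU n A \<mu> \<mu>2"
    and "PU \<subseteq> univ U" "\<theta> \<in> Delta L n A"
  shows "\<mu>1 \<theta> = \<mu>2 \<theta>"
  using Delta_on_P[OF assms(4,3)] is_tilde_eq[OF assms(1,3,4)] is_tilde_eq[OF assms(2,3,4)] by metis

lemma is_tilde_formula:
  assumes "is_tilde L U PU n A \<mu> \<mu>'" "PU \<subseteq> univ U"
    and "\<psi> \<in> formulas L n A" "\<chi> \<in> formulas L n A"
  shows "\<mu>' (Disj (Conj (lift \<psi>) (P_all n)) (Conj (lift \<chi>) (Neg (P_all n)))) = \<mu> \<psi>"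
  by (rule is_tilde_eq[OF assms(1,2)])
    (use assms(2-4) solutions_subset[of U n \<psi>] in
      \<open>auto simp: solutions_P_all intro!: Delta.intros\<close>)

lemma is_tilde_exists:
  fixes \<mu> :: "('f, 'r, 'a) fm \<Rightarrow> real"
  assumes "L_measure L U n A \<mu>" "fin_satisfiable L U n A \<mu> B" "B \<subseteq> PU" "PU \<subseteq> univ U"
  shows "\<exists>\<mu>'. is_tilde L U PU n A \<mu> \<mu>'"
proof -
  let ?F = "formulas L n A" and ?Q = "tuples PU n"
  note bc = bool_closed_formulas[of L n A]
  define rep where "rep \<theta> \<psi> \<longleftrightarrow> \<psi> \<in> ?F \<and>
      solutions (pair U PU) n \<theta> \<inter> ?Q = solutions U n \<psi> \<inter> ?Q" for \<theta> \<psi>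
  define \<mu>' where "\<mu>' \<theta> = \<mu> (SOME \<psi>. rep \<theta> \<psi>)" for \<theta>
  have m: "fa_measure U n ?F \<mu>"
    using assms(1) by (simp add: L_measure_def)
  have BQ: "tuples B n \<subseteq> ?Q"
    using assms(3) by (auto simp: tuples_def)
  have QU: "?Q \<subseteq> tuples (univ U) n"
    using assms(4) by (auto simp: tuples_def)
  have null: "\<mu> \<alpha> = 0" if "\<alpha> \<in> ?F" "solutions U n \<alpha> \<inter> ?Q = {}" for \<alpha>
  proof (rule ccontr)
    assume "\<mu> \<alpha> \<noteq> 0"
    moreover have "0 \<le> \<mu> \<alpha>"
      using m that(1) unfolding fa_measure_def by metis
    ultimately have "0 < \<mu> \<alpha>" by simp
    then have "\<exists>as \<in> tuples B n. holds U \<alpha> as"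
      using assms(2) that(1) unfolding fin_satisfiable_def by blast
    then obtain as where "as \<in> tuples B n" "holds U \<alpha> as" by blast
    then have "as \<in> solutions U n \<alpha> \<inter> ?Q"
      using BQ QU by (auto simp: solutions_def)
    then show False using that(2) by blast
  qed
  have eqQ: "\<mu> \<alpha> = \<mu> \<beta>"
    if "\<alpha> \<in> ?F" "\<beta> \<in> ?F" "solutions U n \<alpha> \<inter> ?Q = solutions U n \<beta> \<inter> ?Q" for \<alpha> \<beta>
  proof (rule fa_measure_eqI[OF m bc that(1,2)])
    show "\<mu> (Conj \<alpha> (Neg \<beta>)) = 0"
      by (rule null) (use that bc in \<open>auto simp: bool_closed_def\<close>)
    show "\<mu> (Conj \<beta> (Neg \<alpha>)) = 0"
      by (rule null) (use that bc in \<open>auto simp: bool_closed_def\<close>)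
  qed
  have val: "\<mu>' \<theta> = \<mu> \<psi>" if "rep \<theta> \<psi>" for \<theta> \<psi>
  proof -
    have "\<mu> \<chi> = \<mu> \<psi>" if "rep \<theta> \<chi>" for \<chi>
      using that \<open>rep \<theta> \<psi>\<close> by (intro eqQ) (auto simp: rep_def)
    then show ?thesis
      unfolding \<mu>'_def using someI[of "rep \<theta>", OF that] by blast
  qed
  have ex: "\<exists>\<psi>. rep \<theta> \<psi>" if "\<theta> \<in> Delta L n A" for \<theta>
    using Delta_on_P[OF that assms(4)] by (auto simp: rep_def)
  have Tru: "Tru \<in> ?F" "\<mu> Tru = 1"
    using bc m by (auto simp: bool_closed_def fa_measure_def)
  have "fa_measure (pair U PU) n (Delta L n A) \<mu>'"
    unfolding fa_measure_def
  proof (intro conjI ballI impI)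
    fix \<theta> \<eta> assume "\<theta> \<in> Delta L n A"
      and *: "solutions (pair U PU) n \<theta> = solutions (pair U PU) n \<eta>"
    then obtain \<psi> where "rep \<theta> \<psi>" using ex by blast
    moreover from this have "rep \<eta> \<psi>" using * by (simp add: rep_def)
    ultimately show "\<mu>' \<theta> = \<mu>' \<eta>" using val by simp
  next
    fix \<theta> assume "\<theta> \<in> Delta L n A"
    then obtain \<psi> where "rep \<theta> \<psi>" using ex by blast
    moreover from this have "0 \<le> \<mu> \<psi>"
      using m unfolding rep_def fa_measure_def by blast
    ultimately show "0 \<le> \<mu>' \<theta>" using val by simp
  next
    have "rep Tru Tru" using Tru by (simp add: rep_def)
    then show "\<mu>' Tru = 1" using val Tru by simp
  next
    fix \<theta> \<eta> assume D: "\<theta> \<in> Delta L n A" "\<eta> \<in> Delta L n A"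
      and disj: "solutions (pair U PU) n \<theta> \<inter> solutions (pair U PU) n \<eta> = {}"
    obtain \<psi> \<chi> where r: "rep \<theta> \<psi>" "rep \<eta> \<chi>" using D ex by blast
    let ?\<chi> = "Conj \<chi> (Neg \<psi>)"
    have F: "\<psi> \<in> ?F" "?\<chi> \<in> ?F" "Disj \<psi> ?\<chi> \<in> ?F"
      using r bc by (auto simp: rep_def bool_closed_def)
    have "rep \<eta> ?\<chi>"
      using r F disj QU unfolding rep_def by auto
    moreover from this have "rep (Disj \<theta> \<eta>) (Disj \<psi> ?\<chi>)"
      using r(1) F(3) by (simp add: rep_def) blast
    moreover have "solutions U n \<psi> \<inter> solutions U n ?\<chi> = {}" by auto
    then have "\<mu> (Disj \<psi> ?\<chi>) = \<mu> \<psi> + \<mu> ?\<chi>"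
      using m F(1,2) unfolding fa_measure_def by blast
    ultimately show "\<mu>' (Disj \<theta> \<eta>) = \<mu>' \<theta> + \<mu>' \<eta>"
      using val r(1) by simp
  qed
  moreover have "rep (P_all n) Tru"
    using Tru QU assms(4) by (auto simp: rep_def solutions_P_all)
  then have "\<mu>' (P_all n) = 1" using val Tru by simp
  moreover have "\<mu>' (lift \<phi>) = \<mu> \<phi>" if "\<phi> \<in> ?F" for \<phi>
    using that by (intro val) (simp add: rep_def)
  ultimately show ?thesis
    unfolding is_tilde_def Delta_measure_def by blast
qed

end

theory Submission
  imports Defs "HOL-Analysis.Sigma_Algebra"
begin

text \<open>
  Smoothness means approximation: by compactness and extension of measures, \<open>\<mu>\<close> is smooth over a model
  if and only if every definable set, with arbitrary parameters, can be enclosed between two sets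
  definable over the model whose measures are close.  So there is, for the fibres \<open>\<phi>(x, b)\<close> of one
  formula, a finite list of pairs of \<open>\<Delta>\<close>-formulas over \<open>M'\<close>, one of which encloses each fibre
  (\<open>uniform_sandwich_on_predicate\<close>).  On \<open>P\<close>, which carries all the measure, a \<open>\<Delta>\<close>-formula is an
  \<open>L(M')\<close>-formula.  The task is to turn these enclosures, which hold on \<open>P\<close> and use parameters of
  \<open>M'\<close>, into enclosures that hold everywhere and use parameters of \<open>M\<close>.

  The enclosures have a first consequence.  Finitely many weighted points of \<open>M\<close> compute the
  measure of the enclosing sets exactly, by finite satisfiability, and thus the measure of all fibres
  over \<open>M'\<close> up to a small error (\<open>finite_approximation\<close>).  In particular \<open>\<mu>\<close> is definable over \<open>M\<close>, up to
  a factor 2 (\<open>large_fibres_definable\<close>).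

  NIP enters to show that each set \<open>X\<close> definable over \<open>M'\<close> contains, as far as points of \<open>M\<close> are
  concerned, a set definable over \<open>M\<close> of almost the same measure (\<open>inner_approximation\<close>).  Otherwise
  there is a set \<open>R\<close> of positive measure definable over \<open>M\<close> such that both \<open>X\<close> and its complement have
  points of \<open>M\<close> in all of its subsets definable over \<open>M\<close> that are not tiny.  If each sequence of \<open>K\<close>
  tuples omitted some pattern of the formula defining \<open>X\<close>, definability of \<open>\<mu>\<close> would allow to choose a
  sequence whose terms lie in \<open>X\<close> precisely as prescribed by a pattern that it omits
  (\<open>prescribed_signs\<close>).  But the parameters of \<open>X\<close> realize this pattern.  So for each \<open>K\<close> the formula
  shatters a sequence of \<open>K\<close> tuples, and by saturation an infinite set.

  Replacing the enclosing sets over \<open>M'\<close> by such approximations, from inside, and from outside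
  by passing to complements, gives finitely many pairs of sets over \<open>M\<close> one of which encloses \<open>\<phi>(x, b)\<close>
  on \<open>M\<close>, for each \<open>b\<close> in \<open>M\<close>.  This is a first-order statement over \<open>M\<close>, and passing from \<open>M\<close> to \<open>U\<close> it
  becomes the approximation of all definable sets that smoothness over \<open>M\<close> asks for
  (\<open>sandwich_over_submodel\<close>).
\<close>

section \<open>Finitely additive probability measures on algebras of sets\<close>

locale charge = algebra \<Omega> \<A> for \<Omega> :: "'b set" and \<A> :: "'b set set" +
  fixes m :: "'b set \<Rightarrow> real"
  assumes nonneg: "X \<in> \<A> \<Longrightarrow> 0 \<le> m X"
    and total: "m \<Omega> = 1"
    and additive: "X \<in> \<A> \<Longrightarrow> Y \<in> \<A> \<Longrightarrow> X \<inter> Y = {} \<Longrightarrow> m (X \<union> Y) = m X + m Y"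
begin

lemma m_empty: "m {} = 0"
  using additive[of "{}" "{}"] by simp

lemma m_split:
  assumes "X \<in> \<A>" "Y \<in> \<A>"
  shows "m X = m (X \<inter> Y) + m (X - Y)"
proof -
  have "X \<inter> Y \<in> \<A>" "X - Y \<in> \<A>" "(X \<inter> Y) \<inter> (X - Y) = {}" using assms by auto
  from additive[OF this] show ?thesis by (simp add: Int_Diff_Un)
qed

lemma m_mono:
  assumes "X \<in> \<A>" "Y \<in> \<A>" "X \<subseteq> Y"
  shows "m X \<le> m Y"
  using m_split[OF assms(2,1)] nonneg[of "Y - X"] assms by (simp add: inf.absorb2 Diff)

lemma m_compl: "X \<in> \<A> \<Longrightarrow> m (\<Omega> - X) = 1 - m X"
  using m_split[OF top, of X] sets_into_space[of X] total by (simp add: inf.absorb2)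

lemma m_modular:
  assumes "X \<in> \<A>" "Y \<in> \<A>"
  shows "m (X \<union> Y) + m (X \<inter> Y) = m X + m Y"
proof -
  have "m (X \<union> Y) = m ((X \<union> Y) \<inter> Y) + m ((X \<union> Y) - Y)"
    using assms by (intro m_split) auto
  then show ?thesis using m_split[OF assms] by (simp add: Un_Diff Int_absorb1)
qed

lemma m_le_1: "X \<in> \<A> \<Longrightarrow> m X \<le> 1"
  using m_mono[of X \<Omega>] total sets_into_space by auto

text \<open>
  Points outside \<open>\<Omega>\<close> are ignored, so that the outer charge lives on the full power set of the type and
  pushing it down below needs no side conditions.
\<close>

definition outer :: "'b set \<Rightarrow> real" where
  "outer X = (INF Y \<in> {Y \<in> \<A>. X \<inter> \<Omega> \<subseteq> Y}. m Y)"

lemma outer_bdd: "bdd_below (m ` {Y \<in> \<A>. X \<inter> \<Omega> \<subseteq> Y})"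
  using nonneg by (intro bdd_belowI2[where m = 0]) auto

lemma outer_le: "Y \<in> \<A> \<Longrightarrow> X \<inter> \<Omega> \<subseteq> Y \<Longrightarrow> outer X \<le> m Y"
  unfolding outer_def by (rule cINF_lower[OF outer_bdd]) simp

lemma outer_approx:
  assumes "0 < \<epsilon>"
  obtains Y where "Y \<in> \<A>" "X \<inter> \<Omega> \<subseteq> Y" "m Y < outer X + \<epsilon>"
proof -
  have "{Y \<in> \<A>. X \<inter> \<Omega> \<subseteq> Y} \<noteq> {}" using top by blast
  then have "\<exists>Y \<in> {Y \<in> \<A>. X \<inter> \<Omega> \<subseteq> Y}. m Y < outer X + \<epsilon>"
    using assms outer_bdd unfolding outer_def by (subst cINF_less_iff[symmetric]) auto
  then show thesis using that by blast
qed

lemma outer_empty: "outer {} = 0"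
proof (rule antisym)
  show "outer {} \<le> 0" using outer_le[of "{}" "{}"] m_empty by simp
  show "0 \<le> outer {}" unfolding outer_def using nonneg top by (intro cINF_greatest) auto
qed

lemma outer_UNIV: "outer UNIV = 1"
proof (rule antisym)
  show "outer UNIV \<le> 1" using outer_le[OF top] total by simp
  show "1 \<le> outer UNIV"
    unfolding outer_def using total top sets_into_space
    by (intro cINF_greatest) (auto dest: m_mono[OF top])
qed

end

definition strongly_subadditive :: "('b set \<Rightarrow> real) \<Rightarrow> bool" where
  "strongly_subadditive p \<longleftrightarrow> p {} = 0 \<and> (\<forall>X Y. X \<subseteq> Y \<longrightarrow> p X \<le> p Y) \<and>
     (\<forall>X Y. p (X \<union> Y) + p (X \<inter> Y) \<le> p X + p Y)"

lemma strongly_subadditive_mono: "strongly_subadditive p \<Longrightarrow> X \<subseteq> Y \<Longrightarrow> p X \<le> p Y"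
  by (simp add: strongly_subadditive_def)

lemma (in charge) strongly_subadditive_outer: "strongly_subadditive outer"
  unfolding strongly_subadditive_def
proof (intro conjI allI impI)
  show "outer {} = 0" by (rule outer_empty)
next
  fix X Y :: "'b set" assume "X \<subseteq> Y"
  then show "outer X \<le> outer Y"
    unfolding outer_def using top outer_bdd[unfolded outer_def]
    by (intro cINF_superset_mono) auto
next
  fix X Y :: "'b set"
  show "outer (X \<union> Y) + outer (X \<inter> Y) \<le> outer X + outer Y"
  proof (rule field_le_epsilon)
    fix \<epsilon> :: real assume "0 < \<epsilon>"
    then have "0 < \<epsilon> / 2" by simp
    obtain X' where X': "X' \<in> \<A>" "X \<inter> \<Omega> \<subseteq> X'" "m X' < outer X + \<epsilon> / 2"
      using outer_approx[OF \<open>0 < \<epsilon> / 2\<close>] .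
    obtain Y' where Y': "Y' \<in> \<A>" "Y \<inter> \<Omega> \<subseteq> Y'" "m Y' < outer Y + \<epsilon> / 2"
      using outer_approx[OF \<open>0 < \<epsilon> / 2\<close>] .
    have "outer (X \<union> Y) \<le> m (X' \<union> Y')" "outer (X \<inter> Y) \<le> m (X' \<inter> Y')"
      using X' Y' by (auto intro!: outer_le)
    then show "outer (X \<union> Y) + outer (X \<inter> Y) \<le> outer X + outer Y + \<epsilon>"
      using m_modular[OF X'(1) Y'(1)] X'(3) Y'(3) by linarith
  qed
qed

text \<open>
  Pushing a strongly subadditive function down at the set \<open>E\<close> keeps it strongly subadditive, because
  union and intersection with \<open>E\<close> are lattice homomorphisms.  The result agrees with \<open>p\<close> exactly if
  \<open>p\<close> is modular against \<open>E\<close>: a function that cannot be pushed down any further is modular.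
\<close>

definition push :: "'b set \<Rightarrow> ('b set \<Rightarrow> real) \<Rightarrow> 'b set \<Rightarrow> real" where
  "push E p X = p (X \<union> E) - p E + p (X \<inter> E)"

lemma push_le: "strongly_subadditive p \<Longrightarrow> push E p X \<le> p X"
  unfolding push_def strongly_subadditive_def by (smt (verit))

lemma strongly_subadditive_push:
  assumes "strongly_subadditive p"
  shows "strongly_subadditive (push E p)"
  unfolding strongly_subadditive_def
proof (intro conjI allI impI)
  show "push E p {} = 0" using assms by (simp add: push_def strongly_subadditive_def)
next
  fix X Y :: "'a set" assume "X \<subseteq> Y"
  then have "p (X \<union> E) \<le> p (Y \<union> E)" "p (X \<inter> E) \<le> p (Y \<inter> E)"
    by (auto intro!: strongly_subadditive_mono[OF assms])
  then show "push E p X \<le> push E p Y" by (simp add: push_def)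
next
  fix X Y :: "'a set"
  have "p ((X \<union> E) \<union> (Y \<union> E)) + p ((X \<union> E) \<inter> (Y \<union> E)) \<le> p (X \<union> E) + p (Y \<union> E)"
    "p ((X \<inter> E) \<union> (Y \<inter> E)) + p ((X \<inter> E) \<inter> (Y \<inter> E)) \<le> p (X \<inter> E) + p (Y \<inter> E)"
    using assms unfolding strongly_subadditive_def by blast+
  moreover have "(X \<union> E) \<union> (Y \<union> E) = X \<union> Y \<union> E" "(X \<union> E) \<inter> (Y \<union> E) = X \<inter> Y \<union> E"
    "(X \<inter> E) \<union> (Y \<inter> E) = (X \<union> Y) \<inter> E" "(X \<inter> E) \<inter> (Y \<inter> E) = X \<inter> Y \<inter> E" by auto
  ultimately show "push E p (X \<union> Y) + push E p (X \<inter> Y) \<le> push E p X + push E p Y"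
    unfolding push_def by (smt (verit))
qed

text \<open>For two members of a chain the smaller one serves both terms on the right of the inequality.\<close>

lemma strongly_subadditive_chain_INF:
  assumes "\<C> \<noteq> {}" and sub: "\<And>p. p \<in> \<C> \<Longrightarrow> strongly_subadditive p"
    and chain: "\<And>p q. p \<in> \<C> \<Longrightarrow> q \<in> \<C> \<Longrightarrow> p \<le> q \<or> q \<le> p"
  shows "strongly_subadditive (\<lambda>X. INF p\<in>\<C>. p X)"
proof -
  have pos: "0 \<le> p X" if "p \<in> \<C>" for p X
    using sub[OF that] unfolding strongly_subadditive_def by (metis empty_subsetI)
  have bdd: "bdd_below ((\<lambda>p. p X) ` \<C>)" for X
    using pos by (intro bdd_belowI2[where m = 0]) auto
  have lower: "(INF p\<in>\<C>. p X) \<le> p X" if "p \<in> \<C>" for p X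
    by (rule cINF_lower[OF bdd that])
  show ?thesis
    unfolding strongly_subadditive_def
  proof (intro conjI allI impI)
    have "(INF p\<in>\<C>. p {}) = (INF p\<in>\<C>. 0)"
      using sub by (intro INF_cong) (auto simp: strongly_subadditive_def)
    then show "(INF p\<in>\<C>. p {}) = 0" using assms(1) by simp
  next
    fix X Y :: "'a set" assume "X \<subseteq> Y"
    then show "(INF p\<in>\<C>. p X) \<le> (INF p\<in>\<C>. p Y)"
      using assms(1) by (intro cINF_mono bdd) (auto intro: strongly_subadditive_mono[OF sub])
  next
    fix X Y :: "'a set"
    let ?l = "(INF p\<in>\<C>. p (X \<union> Y)) + (INF p\<in>\<C>. p (X \<inter> Y))"
    have two: "?l \<le> p X + q Y" if pq: "p \<in> \<C>" "q \<in> \<C>" for p q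
    proof -
      obtain r where r: "r \<in> \<C>" "r \<le> p" "r \<le> q"
        using chain[OF pq] pq by blast
      have "?l \<le> r (X \<union> Y) + r (X \<inter> Y)" using lower[OF r(1)] by (intro add_mono) auto
      also have "\<dots> \<le> r X + r Y" using sub[OF r(1)] by (simp add: strongly_subadditive_def)
      also have "\<dots> \<le> p X + q Y" using r by (intro add_mono) (auto simp: le_fun_def)
      finally show ?thesis .
    qed
    have "?l - q Y \<le> (INF p\<in>\<C>. p X)" if "q \<in> \<C>" for q
      using two[OF _ that] assms(1) by (intro cINF_greatest) (auto simp: algebra_simps)
    then have "?l - (INF p\<in>\<C>. p X) \<le> (INF p\<in>\<C>. p Y)"
      using assms(1) by (intro cINF_greatest) (auto simp: algebra_simps)
    then show "?l \<le> (INF p\<in>\<C>. p X) + (INF p\<in>\<C>. p Y)" by simp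
  qed
qed

text \<open>
  Strong subadditivity is preserved by infima of chains and by \<open>push\<close>, so Zorn's lemma gives a minimal
  function, which is modular.
\<close>

lemma modular_minorant:
  assumes "strongly_subadditive p"
  obtains q where "strongly_subadditive q" "q \<le> p" "q UNIV = p UNIV"
    "\<And>X Y. q (X \<union> Y) + q (X \<inter> Y) = q X + q Y"
proof -
  define \<S> where "\<S> = {q. strongly_subadditive q \<and> q \<le> p \<and> q UNIV = p UNIV}"
  have "\<exists>q \<in> \<S>. \<forall>r \<in> \<S>. r \<le> q \<longrightarrow> r = q"
  proof (rule predicate_Zorn[where P = "\<lambda>q r. r \<le> q" and A = \<S>])
    show "partial_order_on \<S> (relation_of (\<lambda>q r. r \<le> q) \<S>)"
      by (auto simp: relation_of_def partial_order_on_def preorder_on_def refl_on_def trans_def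
          antisym_def intro: order_trans)
  next
    fix \<C> assume \<C>: "\<C> \<in> Chains (relation_of (\<lambda>q r. r \<le> q) \<S>)"
    show "\<exists>u \<in> \<S>. \<forall>q \<in> \<C>. u \<le> q"
    proof (cases "\<C> = {}")
      case True
      then show ?thesis using assms by (auto simp: \<S>_def)
    next
      case False
      have in_S: "q \<in> \<S>" if "q \<in> \<C>" for q
        using \<C> that by (auto simp: Chains_def relation_of_def)
      have chain: "q \<le> r \<or> r \<le> q" if "q \<in> \<C>" "r \<in> \<C>" for q r
        using \<C> that by (auto simp: Chains_def relation_of_def)
      define u where "u X = (INF q\<in>\<C>. q X)" for X
      have u: "strongly_subadditive u"
        unfolding u_def using in_S chain False
        by (intro strongly_subadditive_chain_INF) (auto simp: \<S>_def)
      have "0 \<le> q X" if "q \<in> \<C>" for q X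
        using in_S[OF that] unfolding \<S>_def strongly_subadditive_def
        by (metis (mono_tags, lifting) empty_subsetI mem_Collect_eq)
      then have low: "u \<le> q" if "q \<in> \<C>" for q
        unfolding u_def le_fun_def using that
        by (intro allI cINF_lower bdd_belowI2[where m = 0]) auto
      have "u UNIV = (INF q\<in>\<C>. p UNIV)"
        unfolding u_def using in_S by (intro INF_cong) (auto simp: \<S>_def)
      then have "u UNIV = p UNIV" using False by simp
      moreover have "u \<le> p"
        using False low in_S unfolding \<S>_def by (blast intro: order_trans)
      ultimately show ?thesis using u low by (auto simp: \<S>_def)
    qed
  qed
  then obtain q where q: "q \<in> \<S>" and min: "\<And>r. r \<in> \<S> \<Longrightarrow> r \<le> q \<Longrightarrow> r = q" by blast
  have sub: "strongly_subadditive q" using q by (simp add: \<S>_def)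
  have "push E q = q" for E
  proof (rule min)
    show le: "push E q \<le> q" using push_le[OF sub] by (simp add: le_fun_def)
    have "push E q UNIV = q UNIV" by (simp add: push_def)
    then show "push E q \<in> \<S>"
      using q le strongly_subadditive_push[OF sub] by (auto simp: \<S>_def intro: order_trans)
  qed
  then have "q (X \<union> Y) + q (X \<inter> Y) = q X + q Y" for X Y
    unfolding push_def by (smt (verit))
  then show thesis using that q by (auto simp: \<S>_def)
qed

text \<open>
  Pushing the outer charge down at \<open>X\<close> lowers its value at the complement of \<open>X\<close> to \<open>1 - outer X\<close>.  A
  modular function below the result has no freedom at \<open>X\<close> and at the members of the algebra: there
  the upper bounds for the set and for its complement add up to the total mass 1.
\<close>

lemma (in charge) extension_outer:
  obtains q where "charge \<Omega> (Pow \<Omega>) q" "\<And>A. A \<in> \<A> \<Longrightarrow> q A = m A" "q (X \<inter> \<Omega>) = outer X"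
proof -
  note out = strongly_subadditive_outer
  obtain q where q: "strongly_subadditive q" "q \<le> push X outer" "q UNIV = push X outer UNIV"
    and mod: "\<And>A B. q (A \<union> B) + q (A \<inter> B) = q A + q B"
    using modular_minorant[OF strongly_subadditive_push[OF out]] by metis
  have one: "q UNIV = 1" using q(3) outer_UNIV by (simp add: push_def)
  have le: "q A \<le> outer A" for A
    using q(2) push_le[OF out] by (meson le_fun_def order_trans)
  have empty: "q {} = 0" and pos: "0 \<le> q A" for A
    using q(1) unfolding strongly_subadditive_def by (metis, metis empty_subsetI)
  have compl: "q A + q (- A) = 1" for A
    using mod[of A "- A"] one empty by simp
  have "outer (- \<Omega>) \<le> 0"
    using outer_le[OF empty_sets] m_empty by simp
  then have "q (- \<Omega>) = 0" using le[of "- \<Omega>"] pos[of "- \<Omega>"] by linarith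
  then have space: "q \<Omega> = 1" using compl[of \<Omega>] by simp
  show thesis
  proof
    show "charge \<Omega> (Pow \<Omega>) q"
    proof (intro charge.intro charge_axioms.intro)
      show "algebra \<Omega> (Pow \<Omega>)" by (rule algebra_Pow)
      show "q (A \<union> B) = q A + q B" if "A \<inter> B = {}" for A B
        using mod[of A B] empty that by simp
    qed (use pos space in auto)
  next
    fix A assume A: "A \<in> \<A>"
    have "q A \<le> m A" using le[of A] outer_le[of A A] A by force
    moreover have "q (- A) \<le> m (\<Omega> - A)"
      using le[of "- A"] outer_le[of "\<Omega> - A" "- A"] A by force
    ultimately show "q A = m A" using compl[of A] m_compl[OF A] by linarith
  next
    have "q (- X) \<le> push X outer (- X)" using q(2) by (simp add: le_fun_def)
    then have "q (- X) \<le> 1 - outer X"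
      by (simp add: push_def outer_UNIV outer_empty)
    then have "q X = outer X" using compl[of X] le[of X] by linarith
    moreover have "q (X \<inter> \<Omega>) + q (X \<union> \<Omega>) = q X + 1"
      using mod[of X \<Omega>] space by simp
    moreover have "q (X \<union> \<Omega>) = 1"
    proof -
      have "q (- (X \<union> \<Omega>)) \<le> q (- \<Omega>)"
        using q(1) unfolding strongly_subadditive_def by (metis Compl_anti_mono sup_ge2)
      then show ?thesis
        using compl[of "X \<union> \<Omega>"] pos[of "- (X \<union> \<Omega>)"] \<open>q (- \<Omega>) = 0\<close> by linarith
    qed
    ultimately show "q (X \<inter> \<Omega>) = outer X" by linarith
  qed
qed

text \<open>
  Of the extensions with the values \<open>outer X\<close> and \<open>1 - outer (\<Omega> - X)\<close> at \<open>X\<close>, the first is the largest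
  possible and the second the smallest, so uniqueness at \<open>X\<close> closes the gap between approximation
  from inside and from outside.
\<close>

lemma (in charge) sandwich_if_unique_extension:
  assumes "X \<subseteq> \<Omega>" "0 < \<epsilon>"
    and unique: "\<And>q r. charge \<Omega> (Pow \<Omega>) q \<Longrightarrow> charge \<Omega> (Pow \<Omega>) r \<Longrightarrow>
      (\<And>A. A \<in> \<A> \<Longrightarrow> q A = m A) \<Longrightarrow> (\<And>A. A \<in> \<A> \<Longrightarrow> r A = m A) \<Longrightarrow> q X = r X"
  shows "\<exists>A \<in> \<A>. \<exists>B \<in> \<A>. A \<subseteq> X \<and> X \<subseteq> B \<and> m B - m A < \<epsilon>"
proof -
  obtain q where q: "charge \<Omega> (Pow \<Omega>) q" "\<And>A. A \<in> \<A> \<Longrightarrow> q A = m A" "q (X \<inter> \<Omega>) = outer X"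
    using extension_outer[of X] by blast
  obtain r where r: "charge \<Omega> (Pow \<Omega>) r" "\<And>A. A \<in> \<A> \<Longrightarrow> r A = m A"
      "r ((\<Omega> - X) \<inter> \<Omega>) = outer (\<Omega> - X)"
    using extension_outer[of "\<Omega> - X"] by blast
  have "(\<Omega> - X) \<inter> \<Omega> = \<Omega> - X" by blast
  then have "r X = 1 - outer (\<Omega> - X)"
    using r(3) charge.m_compl[OF r(1), of X] assms(1) by simp
  moreover have "q X = outer X" using q(3) assms(1) by (simp add: inf.absorb1)
  ultimately have sum: "outer X + outer (\<Omega> - X) = 1"
    using unique[OF q(1) r(1) q(2) r(2)] by simp
  have "0 < \<epsilon> / 2" using assms by simp
  obtain B where B: "B \<in> \<A>" "X \<inter> \<Omega> \<subseteq> B" "m B < outer X + \<epsilon> / 2"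
    using outer_approx[OF \<open>0 < \<epsilon> / 2\<close>] .
  obtain C where C: "C \<in> \<A>" "(\<Omega> - X) \<inter> \<Omega> \<subseteq> C" "m C < outer (\<Omega> - X) + \<epsilon> / 2"
    using outer_approx[OF \<open>0 < \<epsilon> / 2\<close>] .
  have "m B - m (\<Omega> - C) < \<epsilon>" using B(3) C(3) sum m_compl[OF C(1)] by linarith
  moreover have "\<Omega> - C \<subseteq> X" "X \<subseteq> B" using B(2) C(2) assms(1) by auto
  ultimately show ?thesis using B(1) C(1) by blast
qed

section \<open>Substitution\<close>

text \<open>
  One capture-avoiding substitution for variables and parameters at once: it instantiates variables by
  parameters, renames variables, and turns parameters back into variables.
\<close>

primrec subst_trm :: "('f, 'a) trm \<Rightarrow> (nat \<Rightarrow> ('f, 'a) trm) \<Rightarrow> ('a \<Rightarrow> ('f, 'a) trm) \<Rightarrow> ('f, 'a) trm" where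
  "subst_trm (Var i) s c = s i"
| "subst_trm (Cst a) s c = c a"
| "subst_trm (Fun f ts) s c = Fun f (map (\<lambda>t. subst_trm t s c) ts)"

definition fresh_var :: "('f, 'r, 'a) fm \<Rightarrow> (nat \<Rightarrow> ('f, 'a) trm) \<Rightarrow> ('a \<Rightarrow> ('f, 'a) trm) \<Rightarrow> nat" where
  "fresh_var \<phi> s c = (SOME k. k \<notin> (\<Union>j\<in>fv \<phi>. fv_trm (s j)) \<union> (\<Union>a\<in>set3_fm \<phi>. fv_trm (c a)))"

primrec subst ::
    "('f, 'r, 'a) fm \<Rightarrow> (nat \<Rightarrow> ('f, 'a) trm) \<Rightarrow> ('a \<Rightarrow> ('f, 'a) trm) \<Rightarrow> ('f, 'r, 'a) fm" where
  "subst Tru s c = Tru"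
| "subst (Eq t u) s c = Eq (subst_trm t s c) (subst_trm u s c)"
| "subst (Rel r ts) s c = Rel r (map (\<lambda>t. subst_trm t s c) ts)"
| "subst (Neg \<phi>) s c = Neg (subst \<phi> s c)"
| "subst (Conj \<phi> \<psi>) s c = Conj (subst \<phi> s c) (subst \<psi> s c)"
| "subst (Ex i \<phi>) s c = (let k = fresh_var (Ex i \<phi>) s c in Ex k (subst \<phi> (s(i := Var k)) c))"

lemma finite_fv_trm: "finite (fv_trm t)"
  by (induction t) auto

lemma finite_fv: "finite (fv \<phi>)"
  by (induction \<phi>) (auto simp: finite_fv_trm)

lemma finite_constants_trm: "finite (set2_trm t)"
  by (induction t) auto

lemma finite_constants: "finite (set3_fm \<phi>)"
  by (induction \<phi>) (auto simp: finite_constants_trm)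

lemma fresh_var:
  fixes \<phi> :: "('f, 'r, 'a) fm" and s :: "nat \<Rightarrow> ('f, 'a) trm" and c :: "'a \<Rightarrow> ('f, 'a) trm"
  shows "j \<in> fv \<phi> \<Longrightarrow> fresh_var \<phi> s c \<notin> fv_trm (s j)"
    and "a \<in> set3_fm \<phi> \<Longrightarrow> fresh_var \<phi> s c \<notin> fv_trm (c a)"
proof -
  have "\<exists>k. k \<notin> (\<Union>j\<in>fv \<phi>. fv_trm (s j)) \<union> (\<Union>a\<in>set3_fm \<phi>. fv_trm (c a))"
    by (rule ex_new_if_finite) (auto simp: finite_fv finite_fv_trm finite_constants)
  from someI_ex[OF this, folded fresh_var_def]
  show "j \<in> fv \<phi> \<Longrightarrow> fresh_var \<phi> s c \<notin> fv_trm (s j)"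
    and "a \<in> set3_fm \<phi> \<Longrightarrow> fresh_var \<phi> s c \<notin> fv_trm (c a)" by auto
qed

lemma trm_val_cong: "\<forall>i \<in> fv_trm t. e i = e' i \<Longrightarrow> trm_val N e t = trm_val N e' t"
  by (induction t) (auto intro!: arg_cong[where f = "fn N _"])

lemma sat_cong: "(\<And>i. i \<in> fv \<phi> \<Longrightarrow> e i = e' i) \<Longrightarrow> sat N e \<phi> = sat N e' \<phi>"
proof (induction \<phi> arbitrary: e e')
  case (Eq t u)
  then have "trm_val N e t = trm_val N e' t" "trm_val N e u = trm_val N e' u"
    by (auto intro!: trm_val_cong)
  then show ?case by simp
next
  case (Rel r ts)
  then have "map (trm_val N e) ts = map (trm_val N e') ts" by (auto intro!: trm_val_cong)
  then show ?case by (metis sat.simps(3))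
next
  case (Conj \<phi> \<psi>)
  then have "sat N e \<phi> = sat N e' \<phi>" "sat N e \<psi> = sat N e' \<psi>" by (metis UnCI fv.simps(5))+
  then show ?case by simp
next
  case (Ex i \<phi>)
  have "sat N (e(i := a)) \<phi> = sat N (e'(i := a)) \<phi>" for a
    by (rule Ex.IH) (use Ex.prems in auto)
  then show ?case by simp
next
  case (Neg \<phi>)
  then show ?case by (metis fv.simps(4) sat.simps(4))
qed simp

lemma trm_val_subst:
  "\<forall>a \<in> set2_trm t. trm_val N e (c a) = a \<Longrightarrow>
    trm_val N e (subst_trm t s c) = trm_val N (\<lambda>i. trm_val N e (s i)) t"
  by (induction t) (auto intro!: arg_cong[where f = "fn N _"])

lemma sat_subst:
  "(\<And>a. a \<in> set3_fm \<phi> \<Longrightarrow> trm_val N e (c a) = a) \<Longrightarrow>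
    sat N e (subst \<phi> s c) = sat N (\<lambda>i. trm_val N e (s i)) \<phi>"
proof (induction \<phi> arbitrary: e s)
  case (Eq t u)
  then show ?case by (simp add: trm_val_subst)
next
  case (Rel r ts)
  then have "map (trm_val N e) (map (\<lambda>t. subst_trm t s c) ts)
      = map (trm_val N (\<lambda>i. trm_val N e (s i))) ts"
    by (auto intro!: trm_val_subst)
  then show ?case by (metis sat.simps(3) subst.simps(3))
next
  case (Ex i \<phi>)
  define k where "k = fresh_var (Ex i \<phi>) s c"
  have "sat N (e(k := b)) (subst \<phi> (s(i := Var k)) c) = sat N ((\<lambda>i. trm_val N e (s i))(i := b)) \<phi>" for b
  proof -
    have c: "trm_val N (e(k := b)) (c a) = a" if "a \<in> set3_fm \<phi>" for a
    proof -
      have "trm_val N (e(k := b)) (c a) = trm_val N e (c a)"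
        using fresh_var(2)[of a "Ex i \<phi>" s c] that by (intro trm_val_cong) (auto simp: k_def)
      then show ?thesis using Ex.prems that by simp
    qed
    have "sat N (e(k := b)) (subst \<phi> (s(i := Var k)) c)
        = sat N (\<lambda>j. trm_val N (e(k := b)) ((s(i := Var k)) j)) \<phi>"
      by (rule Ex.IH) (rule c)
    also have "\<dots> = sat N ((\<lambda>i. trm_val N e (s i))(i := b)) \<phi>"
    proof (rule sat_cong)
      fix j assume j: "j \<in> fv \<phi>"
      show "trm_val N (e(k := b)) ((s(i := Var k)) j) = ((\<lambda>i. trm_val N e (s i))(i := b)) j"
      proof (cases "j = i")
        case False
        then have "k \<notin> fv_trm (s j)"
          using fresh_var(1)[of j "Ex i \<phi>" s c] j by (simp add: k_def)
        then have "trm_val N (e(k := b)) (s j) = trm_val N e (s j)"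
          by (intro trm_val_cong) auto
        then show ?thesis using False by simp
      qed simp
    qed
    finally show ?thesis .
  qed
  then show ?case by (simp add: Let_def k_def[symmetric])
qed auto

lemma trm_ok_subst:
  "trm_ok L A t \<Longrightarrow> \<forall>i \<in> fv_trm t. trm_ok L B (s i) \<Longrightarrow> \<forall>a \<in> set2_trm t. trm_ok L B (c a) \<Longrightarrow> trm_ok L B (subst_trm t s c)"
  by (induction t) (auto simp: list_all_iff)

lemma fm_ok_subst:
  "fm_ok L A \<phi> \<Longrightarrow> (\<And>i. i \<in> fv \<phi> \<Longrightarrow> trm_ok L B (s i)) \<Longrightarrow>
    (\<And>a. a \<in> set3_fm \<phi> \<Longrightarrow> trm_ok L B (c a)) \<Longrightarrow> fm_ok L B (subst \<phi> s c)"
proof (induction \<phi> arbitrary: s)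
  case (Ex i \<phi>)
  then show ?case by (auto simp: Let_def intro!: Ex.IH)
qed (auto simp: list_all_iff intro!: trm_ok_subst)

lemma fv_subst_trm:
  "fv_trm (subst_trm t s c) \<subseteq> (\<Union>j\<in>fv_trm t. fv_trm (s j)) \<union> (\<Union>a\<in>set2_trm t. fv_trm (c a))"
  by (induction t) (auto simp: subset_iff, blast+)

lemma fv_subst:
  "fv (subst \<phi> s c) \<subseteq> (\<Union>j\<in>fv \<phi>. fv_trm (s j)) \<union> (\<Union>a\<in>set3_fm \<phi>. fv_trm (c a))"
proof (induction \<phi> arbitrary: s)
  case (Eq t u)
  show ?case using fv_subst_trm[of t s c] fv_subst_trm[of u s c] by auto
next
  case (Rel r ts)
  show ?case
  proof
    fix i assume "i \<in> fv (subst (Rel r ts) s c)"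
    then obtain t where "t \<in> set ts" "i \<in> fv_trm (subst_trm t s c)" by auto
    then show "i \<in> (\<Union>j\<in>fv (Rel r ts). fv_trm (s j)) \<union> (\<Union>a\<in>set3_fm (Rel r ts). fv_trm (c a))"
      using fv_subst_trm[of t s c] by simp blast
  qed
next
  case (Conj \<phi> \<psi>)
  show ?case using Conj.IH[of s] by auto
next
  case (Ex i \<phi>)
  define k where "k = fresh_var (Ex i \<phi>) s c"
  show ?case
  proof
    fix l assume "l \<in> fv (subst (Ex i \<phi>) s c)"
    then have l: "l \<in> fv (subst \<phi> (s(i := Var k)) c)" "l \<noteq> k"
      by (auto simp: Let_def k_def[symmetric])
    then consider j where "j \<in> fv \<phi>" "l \<in> fv_trm ((s(i := Var k)) j)"
      | a where "a \<in> set3_fm \<phi>" "l \<in> fv_trm (c a)"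
      using Ex.IH[of "s(i := Var k)"] by blast
    then show "l \<in> (\<Union>j\<in>fv (Ex i \<phi>). fv_trm (s j)) \<union> (\<Union>a\<in>set3_fm (Ex i \<phi>). fv_trm (c a))"
      by cases (use l(2) in \<open>auto split: if_splits\<close>)
  qed
qed auto

lemma constants_subset_trm: "trm_ok L A t \<Longrightarrow> set2_trm t \<subseteq> A"
  by (induction t) (auto simp: list_all_iff)

lemma constants_subset: "fm_ok L A \<phi> \<Longrightarrow> set3_fm \<phi> \<subseteq> A"
  by (induction \<phi>) (auto simp: list_all_iff dest: constants_subset_trm)

lemma trm_ok_mono: "trm_ok L A t \<Longrightarrow> A \<subseteq> B \<Longrightarrow> trm_ok L B t"
  by (induction t) (auto simp: list_all_iff)

lemma fm_ok_mono: "fm_ok L A \<phi> \<Longrightarrow> A \<subseteq> B \<Longrightarrow> fm_ok L B \<phi>"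
  by (induction \<phi>) (auto simp: list_all_iff intro: trm_ok_mono)

text \<open>Replacing the free variables by parameters turns an assertion about a tuple into a sentence.\<close>

lemma elementary_sub_sat:
  assumes "elementary_sub L M N" "fm_ok L (univ M) \<phi>" "\<And>i. i \<in> fv \<phi> \<Longrightarrow> e i \<in> univ M"
  shows "sat M e \<phi> = sat N e \<phi>"
proof -
  let ?\<sigma> = "subst \<phi> (\<lambda>i. Cst (e i)) Cst"
  have "fm_ok L (univ M) ?\<sigma>" by (rule fm_ok_subst[OF assms(2)]) (use assms(3) constants_subset[OF assms(2)] in auto)
  moreover have "fv ?\<sigma> \<subseteq> {}" using fv_subst[of \<phi> "\<lambda>i. Cst (e i)" Cst] by auto
  ultimately have "?\<sigma> \<in> formulas L 0 (univ M)" by (simp add: formulas_def)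
  then have "holds M ?\<sigma> [] = holds N ?\<sigma> []" using assms(1) by (simp add: elementary_sub_def)
  then show ?thesis by (simp add: holds_def sat_subst)
qed

section \<open>Definable sets\<close>

text \<open>
  The arguments about formulas are carried out with these sets, so that quantifiers, parameters and
  changes of variables appear as closure properties.
\<close>

definition definable :: "('f, 'r) lang \<Rightarrow> ('a, 'f, 'r) struct \<Rightarrow> nat \<Rightarrow> 'a set \<Rightarrow> 'a list set set" where
  "definable L N k A = solutions N k ` formulas L k A"

lemma algebra_definable: "algebra (tuples (univ N) k) (definable L N k A)"
  unfolding algebra_iff_Int
proof (intro conjI ballI)
  show "definable L N k A \<subseteq> Pow (tuples (univ N) k)"
    using solutions_subset by (auto simp: definable_def)
  have "solutions N k (Neg Tru) = {}" by simp
  moreover have "Neg Tru \<in> formulas L k A" by (simp add: formulas_def)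
  ultimately show "{} \<in> definable L N k A" unfolding definable_def by blast
next
  fix X assume "X \<in> definable L N k A"
  then obtain \<phi> where "\<phi> \<in> formulas L k A" "X = solutions N k \<phi>" by (auto simp: definable_def)
  then have "Neg \<phi> \<in> formulas L k A" "tuples (univ N) k - X = solutions N k (Neg \<phi>)"
    by (simp_all add: formulas_def)
  then show "tuples (univ N) k - X \<in> definable L N k A" unfolding definable_def by blast
next
  fix X Y assume "X \<in> definable L N k A" "Y \<in> definable L N k A"
  then obtain \<phi> \<psi> where "\<phi> \<in> formulas L k A" "X = solutions N k \<phi>"
      "\<psi> \<in> formulas L k A" "Y = solutions N k \<psi>" by (auto simp: definable_def)
  then have "Conj \<phi> \<psi> \<in> formulas L k A" "X \<inter> Y = solutions N k (Conj \<phi> \<psi>)"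
    by (simp_all add: formulas_def)
  then show "X \<inter> Y \<in> definable L N k A" unfolding definable_def by blast
qed

interpretation definable: algebra "tuples (univ N) k" "definable L N k A" for L N k A
  by (rule algebra_definable)

lemma definable_mono: "A \<subseteq> B \<Longrightarrow> X \<in> definable L N k A \<Longrightarrow> X \<in> definable L N k B"
  unfolding definable_def formulas_def using fm_ok_mono by blast

lemma solutions_definable: "\<phi> \<in> formulas L k A \<Longrightarrow> solutions N k \<phi> \<in> definable L N k A"
  by (simp add: definable_def)

lemma member_Collect_cong:
  "{x \<in> S. P x} \<in> \<D> \<Longrightarrow> (\<And>x. x \<in> S \<Longrightarrow> P x \<longleftrightarrow> Q x) \<Longrightarrow> {x \<in> S. Q x} \<in> \<D>"
  by (metis (mono_tags, lifting) Collect_cong)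

lemma tuples_append: "as \<in> tuples A k \<Longrightarrow> bs \<in> tuples A l \<Longrightarrow> as @ bs \<in> tuples A (k + l)"
  by (auto simp: tuples_def)

lemma tuples_mono: "A \<subseteq> B \<Longrightarrow> as \<in> tuples A k \<Longrightarrow> as \<in> tuples B k"
  by (auto simp: tuples_def)

lemma tuples_nth: "as \<in> tuples A k \<Longrightarrow> i < k \<Longrightarrow> as ! i \<in> A"
  by (auto simp: tuples_def)

text \<open>The common source of the closure properties below that need no quantifier.\<close>

lemma definable_subst:
  fixes L :: "('f, 'r) lang"
  assumes X: "X \<in> definable L N k A" and "A \<subseteq> B"
    and s: "\<And>i. i < k \<Longrightarrow> (\<exists>j < l. s i = Var j) \<or> (\<exists>a \<in> B. s i = (Cst a :: ('f, 'a) trm))"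
    and "B \<subseteq> univ N"
  shows "{as \<in> tuples (univ N) l. map (\<lambda>i. trm_val N (nth as) (s i)) [0..<k] \<in> X} \<in> definable L N l B"
proof -
  obtain \<phi> where \<phi>: "fm_ok L A \<phi>" "fv \<phi> \<subseteq> {..<k}" "X = solutions N k \<phi>"
    using X by (auto simp: definable_def formulas_def)
  let ?\<psi> = "subst \<phi> s Cst"
  have "fm_ok L B ?\<psi>"
  proof (rule fm_ok_subst[OF \<phi>(1)])
    fix i assume "i \<in> fv \<phi>"
    then have "i < k" using \<phi>(2) by auto
    then show "trm_ok L B (s i)" using s[of i] by auto
  qed (use \<open>A \<subseteq> B\<close> constants_subset[OF \<phi>(1)] in auto)
  moreover have "fv ?\<psi> \<subseteq> {..<l}"
  proof
    fix j assume "j \<in> fv ?\<psi>"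
    then obtain i where "i \<in> fv \<phi>" "j \<in> fv_trm (s i)" using fv_subst[of \<phi> s Cst] by auto
    moreover from this have "i < k" using \<phi>(2) by auto
    ultimately show "j \<in> {..<l}" using s[of i] by auto
  qed
  ultimately have "?\<psi> \<in> formulas L l B" by (simp add: formulas_def)
  moreover have "map (\<lambda>i. trm_val N (nth as) (s i)) [0..<k] \<in> X \<longleftrightarrow> holds N ?\<psi> as"
    if as: "as \<in> tuples (univ N) l" for as
  proof -
    let ?bs = "map (\<lambda>i. trm_val N (nth as) (s i)) [0..<k]"
    have "trm_val N (nth as) (s i) \<in> univ N" if "i < k" for i
      using s[OF that] tuples_nth[OF as] \<open>B \<subseteq> univ N\<close> by auto
    then have "?bs \<in> tuples (univ N) k" by (auto simp: tuples_def)
    then have "?bs \<in> X \<longleftrightarrow> sat N (nth ?bs) \<phi>" by (simp add: \<phi>(3) solutions_def holds_def)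
    also have "\<dots> \<longleftrightarrow> sat N (\<lambda>i. trm_val N (nth as) (s i)) \<phi>"
      using \<phi>(2) by (intro sat_cong) auto
    also have "\<dots> \<longleftrightarrow> holds N ?\<psi> as" by (simp add: holds_def sat_subst)
    finally show ?thesis .
  qed
  then have "{as \<in> tuples (univ N) l. map (\<lambda>i. trm_val N (nth as) (s i)) [0..<k] \<in> X} = solutions N l ?\<psi>"
    by (auto simp: solutions_def)
  ultimately show ?thesis by (simp add: solutions_definable)
qed

lemma definable_reindex:
  assumes "X \<in> definable L N k A" "A \<subseteq> univ N" "\<And>i. i < k \<Longrightarrow> f i < l"
  shows "{as \<in> tuples (univ N) l. map (\<lambda>i. as ! f i) [0..<k] \<in> X} \<in> definable L N l A"
  using definable_subst[OF assms(1) order_refl _ assms(2), of l "\<lambda>i. Var (f i)"] assms(3) by simp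

lemma definable_section:
  assumes "X \<in> definable L N (n + k) A" "A \<subseteq> univ N" "c \<in> tuples A k"
  shows "{as \<in> tuples (univ N) n. as @ c \<in> X} \<in> definable L N n A"
proof -
  let ?s = "\<lambda>i. if i < n then Var i else Cst (c ! (i - n))"
  have D: "{as \<in> tuples (univ N) n. map (\<lambda>i. trm_val N (nth as) (?s i)) [0..<n + k] \<in> X} \<in> definable L N n A"
    by (rule definable_subst[OF assms(1) order_refl _ assms(2)]) (use tuples_nth[OF assms(3)] in auto)
  have eq: "map (\<lambda>i. trm_val N (nth as) (?s i)) [0..<n + k] = as @ c"
    if "as \<in> tuples (univ N) n" for as
    using that assms(3) by (auto simp: list_eq_iff_nth_eq nth_append tuples_def)
  show ?thesis by (rule member_Collect_cong[OF D]) (simp only: eq)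
qed

lemma definable_swap:
  assumes "X \<in> definable L N (n + k) A" "A \<subseteq> univ N"
  shows "{bs \<in> tuples (univ N) (k + n). drop k bs @ take k bs \<in> X} \<in> definable L N (k + n) A"
proof -
  let ?f = "\<lambda>i. if i < n then k + i else i - n"
  have D: "{bs \<in> tuples (univ N) (k + n). map (\<lambda>i. bs ! ?f i) [0..<n + k] \<in> X} \<in> definable L N (k + n) A"
    by (rule definable_reindex[OF assms]) auto
  have eq: "map (\<lambda>i. bs ! ?f i) [0..<n + k] = drop k bs @ take k bs"
    if "bs \<in> tuples (univ N) (k + n)" for bs
    using that by (auto simp: list_eq_iff_nth_eq nth_append tuples_def)
  show ?thesis by (rule member_Collect_cong[OF D]) (simp only: eq)
qed

lemma definable_section_front:
  assumes "X \<in> definable L N (k + n) A" "A \<subseteq> univ N" "c \<in> tuples A k"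
  shows "{as \<in> tuples (univ N) n. c @ as \<in> X} \<in> definable L N n A"
proof -
  have D: "{as \<in> tuples (univ N) n. as @ c \<in> {bs \<in> tuples (univ N) (n + k). drop n bs @ take n bs \<in> X}}
      \<in> definable L N n A"
    by (rule definable_section[OF definable_swap[OF assms(1,2)] assms(2,3)])
  have eq: "as @ c \<in> {bs \<in> tuples (univ N) (n + k). drop n bs @ take n bs \<in> X} \<longleftrightarrow> c @ as \<in> X"
    if "as \<in> tuples (univ N) n" for as
    using that tuples_append[OF that tuples_mono[OF assms(2,3)]] by (simp add: tuples_def)
  show ?thesis by (rule member_Collect_cong[OF D]) (simp only: eq)
qed

lemma definable_cylinder:
  assumes "X \<in> definable L N n A" "A \<subseteq> univ N"
  shows "{as \<in> tuples (univ N) (n + k). take n as \<in> X} \<in> definable L N (n + k) A"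
proof -
  have D: "{as \<in> tuples (univ N) (n + k). map (\<lambda>i. as ! i) [0..<n] \<in> X} \<in> definable L N (n + k) A"
    by (rule definable_reindex[OF assms]) auto
  have eq: "map (\<lambda>i. as ! i) [0..<n] = take n as" if "as \<in> tuples (univ N) (n + k)" for as
    using that by (auto simp: list_eq_iff_nth_eq tuples_def)
  show ?thesis by (rule member_Collect_cong[OF D]) (simp only: eq)
qed

lemma definable_projection:
  assumes "X \<in> definable L N (n + k) A"
  shows "{as \<in> tuples (univ N) n. \<exists>bs \<in> tuples (univ N) k. as @ bs \<in> X} \<in> definable L N n A"
  using assms
proof (induction k arbitrary: X)
  case 0
  have "{as \<in> tuples (univ N) n. \<exists>bs \<in> tuples (univ N) 0. as @ bs \<in> X} = X"
    using definable.sets_into_space[OF 0] by (auto simp: tuples_def)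
  then show ?case using 0 by simp
next
  case (Suc k)
  obtain \<phi> where \<phi>: "fm_ok L A \<phi>" "fv \<phi> \<subseteq> {..<n + Suc k}" "X = solutions N (n + Suc k) \<phi>"
    using Suc.prems by (auto simp: definable_def formulas_def)
  have "Ex (n + k) \<phi> \<in> formulas L (n + k) A" using \<phi> by (auto simp: formulas_def less_Suc_eq)
  then have "solutions N (n + k) (Ex (n + k) \<phi>) \<in> definable L N (n + k) A"
    by (rule solutions_definable)
  note IH = Suc.IH[OF this]
  have last: "as \<in> solutions N (n + k) (Ex (n + k) \<phi>) \<longleftrightarrow> (\<exists>b \<in> univ N. as @ [b] \<in> X)"
    if as: "as \<in> tuples (univ N) (n + k)" for as
  proof -
    have "sat N ((nth as)(n + k := b)) \<phi> \<longleftrightarrow> as @ [b] \<in> X" if "b \<in> univ N" for b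
    proof -
      have "sat N ((nth as)(n + k := b)) \<phi> \<longleftrightarrow> sat N (nth (as @ [b])) \<phi>"
        using \<phi>(2) as by (intro sat_cong) (auto simp: nth_append tuples_def)
      moreover have "as @ [b] \<in> tuples (univ N) (n + Suc k)"
        using as that by (auto simp: tuples_def)
      ultimately show ?thesis by (simp add: \<phi>(3) solutions_def holds_def)
    qed
    then show ?thesis using as by (auto simp: solutions_def holds_def)
  qed
  have "(\<exists>bs \<in> tuples (univ N) k. as @ bs \<in> solutions N (n + k) (Ex (n + k) \<phi>)) \<longleftrightarrow>
      (\<exists>bs \<in> tuples (univ N) (Suc k). as @ bs \<in> X)" if as: "as \<in> tuples (univ N) n" for as
  proof
    assume "\<exists>bs \<in> tuples (univ N) k. as @ bs \<in> solutions N (n + k) (Ex (n + k) \<phi>)"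
    then obtain bs where bs: "bs \<in> tuples (univ N) k" "as @ bs \<in> solutions N (n + k) (Ex (n + k) \<phi>)"
      by blast
    then obtain b where "b \<in> univ N" "(as @ bs) @ [b] \<in> X"
      using last[OF tuples_append[OF as bs(1)]] by blast
    moreover from this bs have "bs @ [b] \<in> tuples (univ N) (Suc k)" by (auto simp: tuples_def)
    ultimately show "\<exists>bs \<in> tuples (univ N) (Suc k). as @ bs \<in> X" by force
  next
    assume "\<exists>bs \<in> tuples (univ N) (Suc k). as @ bs \<in> X"
    then obtain cs where cs: "length cs = Suc k" "set cs \<subseteq> univ N" "as @ cs \<in> X"
      by (auto simp: tuples_def)
    then obtain bs b where "cs = bs @ [b]" by (metis length_Suc_conv_rev)
    then have "bs \<in> tuples (univ N) k" "b \<in> univ N" "(as @ bs) @ [b] \<in> X"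
      using cs by (auto simp: tuples_def)
    then show "\<exists>bs \<in> tuples (univ N) k. as @ bs \<in> solutions N (n + k) (Ex (n + k) \<phi>)"
      using last[OF tuples_append[OF as]] by blast
  qed
  with IH show ?case by (rule member_Collect_cong)
qed

lemma definable_projection_front:
  assumes "X \<in> definable L N (n + k) A" "A \<subseteq> univ N"
  shows "{bs \<in> tuples (univ N) k. \<exists>as \<in> tuples (univ N) n. as @ bs \<in> X} \<in> definable L N k A"
proof (rule member_Collect_cong[OF definable_projection[OF definable_swap[OF assms]]])
  fix bs assume bs: "bs \<in> tuples (univ N) k"
  have "bs @ as \<in> {cs \<in> tuples (univ N) (k + n). drop k cs @ take k cs \<in> X} \<longleftrightarrow> as @ bs \<in> X"
    if "as \<in> tuples (univ N) n" for as
    using bs that tuples_append[OF bs that] by (simp add: tuples_def)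
  then show "(\<exists>as \<in> tuples (univ N) n. bs @ as \<in> {cs \<in> tuples (univ N) (k + n). drop k cs @ take k cs \<in> X})
      \<longleftrightarrow> (\<exists>as \<in> tuples (univ N) n. as @ bs \<in> X)" by (intro bex_cong) auto
qed

text \<open>
  The parameters become the variables from \<open>n\<close> on; the substitution renames the bound variables of
  the formula out of their way.
\<close>

lemma definable_parameters:
  fixes L :: "('f, 'r) lang"
  assumes "X \<in> definable L N n A" "A \<subseteq> univ N"
  obtains k c Y where "c \<in> tuples A k" "Y \<in> definable L N (n + k) {}"
    "X = {as \<in> tuples (univ N) n. as @ c \<in> Y}"
proof -
  obtain \<phi> where \<phi>: "fm_ok L A \<phi>" "fv \<phi> \<subseteq> {..<n}" "X = solutions N n \<phi>"
    using assms(1) by (auto simp: definable_def formulas_def)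
  obtain c where c: "set c = set3_fm \<phi>"
    using finite_list[OF finite_constants[of \<phi>]] by blast
  define g where "g a = (SOME i. i < length c \<and> c ! i = a)" for a
  have g: "g a < length c" "c ! g a = a" if "a \<in> set3_fm \<phi>" for a
  proof -
    have "\<exists>i. i < length c \<and> c ! i = a" using that c by (metis in_set_conv_nth)
    from someI_ex[OF this, folded g_def] show "g a < length c" "c ! g a = a" by auto
  qed
  let ?\<psi> = "subst \<phi> Var (\<lambda>a. Var (n + g a) :: ('f, 'a) trm)"
  let ?k = "length c"
  have "fm_ok L {} ?\<psi>" by (rule fm_ok_subst[OF \<phi>(1)]) auto
  moreover have "fv ?\<psi> \<subseteq> {..<n + ?k}"
  proof
    fix i assume "i \<in> fv ?\<psi>"
    then consider "i \<in> fv \<phi>" | a where "a \<in> set3_fm \<phi>" "i = n + g a"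
      using fv_subst[of \<phi> Var "\<lambda>a. Var (n + g a)"] by auto
    then show "i \<in> {..<n + ?k}" by cases (use \<phi>(2) g(1) in auto)
  qed
  ultimately have \<psi>: "solutions N (n + ?k) ?\<psi> \<in> definable L N (n + ?k) {}"
    by (intro solutions_definable) (simp add: formulas_def)
  have cA: "c \<in> tuples A ?k" using c constants_subset[OF \<phi>(1)] by (simp add: tuples_def)
  have "holds N ?\<psi> (as @ c) \<longleftrightarrow> holds N \<phi> as" if as: "as \<in> tuples (univ N) n" for as
  proof -
    have n: "length as = n" using as by (simp add: tuples_def)
    have "sat N (nth (as @ c)) ?\<psi> \<longleftrightarrow> sat N (\<lambda>i. trm_val N (nth (as @ c)) (Var i)) \<phi>"
      by (rule sat_subst) (use g(2) n in auto)
    also have "\<dots> \<longleftrightarrow> sat N (nth as) \<phi>"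
      using \<phi>(2) n by (intro sat_cong) (auto simp: nth_append)
    finally show ?thesis by (simp add: holds_def)
  qed
  moreover have "as @ c \<in> tuples (univ N) (n + ?k)" if "as \<in> tuples (univ N) n" for as
    by (rule tuples_append[OF that tuples_mono[OF assms(2) cA]])
  ultimately have "X = {as \<in> tuples (univ N) n. as @ c \<in> solutions N (n + ?k) ?\<psi>}"
    unfolding \<phi>(3) solutions_def by blast
  then show thesis using that cA \<psi> by blast
qed

text \<open>
  The coordinates of a point are found one after the other: the first one by elementarity, applied to
  the projection to the first coordinate, and the others in the fibre over it.
\<close>

lemma elementary_sub_definable:
  assumes "elementary_sub L M N" "X \<in> definable L N k (univ M)" "X \<noteq> {}"
  shows "X \<inter> tuples (univ M) k \<noteq> {}"
  using assms(2,3)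
proof (induction k arbitrary: X)
  case 0
  have "X \<subseteq> tuples (univ N) 0" using 0 definable.sets_into_space by blast
  then show ?case using 0 by (auto simp: tuples_def)
next
  case (Suc k)
  have MN: "univ M \<subseteq> univ N" using assms(1) by (simp add: elementary_sub_def)
  have X: "X \<in> definable L N (1 + k) (univ M)" using Suc.prems by simp
  define V where "V = {as \<in> tuples (univ N) 1. \<exists>bs \<in> tuples (univ N) k. as @ bs \<in> X}"
  have "V \<in> definable L N 1 (univ M)" unfolding V_def by (rule definable_projection[OF X])
  then obtain \<psi> where \<psi>: "fm_ok L (univ M) \<psi>" "fv \<psi> \<subseteq> {..<1}" "V = solutions N 1 \<psi>"
    by (auto simp: definable_def formulas_def)
  have one: "[a] \<in> V \<longleftrightarrow> a \<in> univ N \<and> sat N (e(0 := a)) \<psi>" for a e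
  proof -
    have "sat N (e(0 := a)) \<psi> = sat N (nth [a]) \<psi>" using \<psi>(2) by (intro sat_cong) auto
    then show ?thesis by (auto simp: \<psi>(3) solutions_def holds_def tuples_def)
  qed
  obtain as where as: "as \<in> X" using Suc.prems by blast
  then have "as \<in> tuples (univ N) (Suc k)" using Suc.prems definable.sets_into_space by blast
  then obtain b bs where b: "as = b # bs" "b \<in> univ N" "bs \<in> tuples (univ N) k"
    by (cases as) (auto simp: tuples_def)
  then have "[b] \<in> V" using as by (auto simp: V_def tuples_def)
  obtain d where d: "d \<in> univ M"
    using assms(1) by (auto simp: elementary_sub_def is_structure_def)
  define e where "e = (\<lambda>_ :: nat. d)"
  have "sat N e (Ex 0 \<psi>)" using one \<open>[b] \<in> V\<close> by auto
  then have "sat M e (Ex 0 \<psi>)"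
    using elementary_sub_sat[OF assms(1), of "Ex 0 \<psi>" e] \<psi>(1) d by (auto simp: e_def)
  then obtain a where a: "a \<in> univ M" "sat M (e(0 := a)) \<psi>" by auto
  then have "sat N (e(0 := a)) \<psi>"
    using elementary_sub_sat[OF assms(1) \<psi>(1), of "e(0 := a)"] a(1) d by (auto simp: e_def)
  then have "[a] \<in> V" using one a(1) MN by blast
  then have ne: "{bs \<in> tuples (univ N) k. [a] @ bs \<in> X} \<noteq> {}" by (auto simp: V_def)
  have "[a] \<in> tuples (univ M) 1" using a(1) by (simp add: tuples_def)
  from Suc.IH[OF definable_section_front[OF X MN this] ne]
  obtain bs where "bs \<in> tuples (univ M) k" "[a] @ bs \<in> X" by blast
  moreover from this have "[a] @ bs \<in> tuples (univ M) (Suc k)"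
    using a(1) by (auto simp: tuples_def)
  ultimately show ?case by blast
qed

lemma saturated_definable:
  assumes "saturated \<kappa> L N" "A \<subseteq> univ N" "|A| <o \<kappa>" "\<F> \<subseteq> definable L N k A"
    and fin: "\<And>\<G>. finite \<G> \<Longrightarrow> \<G> \<subseteq> \<F> \<Longrightarrow> \<exists>as \<in> tuples (univ N) k. \<forall>X \<in> \<G>. as \<in> X"
  obtains as where "as \<in> tuples (univ N) k" "\<And>X. X \<in> \<F> \<Longrightarrow> as \<in> X"
proof -
  let ?p = "{\<phi> \<in> formulas L k A. solutions N k \<phi> \<in> \<F>}"
  have "\<exists>as \<in> tuples (univ N) k. \<forall>\<phi> \<in> q. holds N \<phi> as" if "finite q" "q \<subseteq> ?p" for q
  proof -
    have "finite (solutions N k ` q)" "solutions N k ` q \<subseteq> \<F>" using that by auto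
    from fin[OF this] show ?thesis by (auto simp: solutions_def)
  qed
  then have "\<exists>as \<in> tuples (univ N) k. \<forall>\<phi> \<in> ?p. holds N \<phi> as"
    using assms(1-3) unfolding saturated_def by (metis (no_types, lifting) mem_Collect_eq subsetI)
  then obtain as where as: "as \<in> tuples (univ N) k" "\<And>\<phi>. \<phi> \<in> ?p \<Longrightarrow> holds N \<phi> as" by blast
  have "as \<in> X" if "X \<in> \<F>" for X
  proof -
    obtain \<phi> where "\<phi> \<in> formulas L k A" "X = solutions N k \<phi>"
      using \<open>X \<in> \<F>\<close> assms(4) by (auto simp: definable_def)
    then show ?thesis using as \<open>X \<in> \<F>\<close> by (auto simp: solutions_def)
  qed
  then show thesis using that as(1) by blast
qed

section \<open>Shattering and saturation\<close>

lemma definable_Ball: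
  assumes "finite S" "\<And>i. i \<in> S \<Longrightarrow> {x \<in> tuples (univ N) k. P i x} \<in> definable L N k A"
  shows "{x \<in> tuples (univ N) k. \<forall>i \<in> S. P i x} \<in> definable L N k A"
proof (cases "S = {}")
  case True
  then show ?thesis using definable.top by simp
next
  case False
  then show ?thesis using assms definable.sets_Collect_finite_All' by blast
qed

definition block :: "nat \<Rightarrow> nat \<Rightarrow> 'a list \<Rightarrow> 'a list" where
  "block n i z = take n (drop (i * n) z)"

lemma block_append:
  assumes "i < K" "length z = K * n"
  shows "block n i (z @ y) = block n i z"
proof -
  have "i * n + n \<le> K * n" using assms(1) by (metis Suc_leI add.commute mult_Suc mult_le_mono1)
  then show ?thesis using assms(2) by (simp add: block_def)
qed

lemma block_Suc: "length a = n \<Longrightarrow> block n (Suc i) (a @ z) = block n i z"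
  by (simp add: block_def)

lemma block_in_tuples:
  assumes "i < K" "z \<in> tuples A (K * n)"
  shows "block n i z \<in> tuples A n"
proof -
  have "i * n + n \<le> K * n" using assms(1) by (metis Suc_leI add.commute mult_Suc mult_le_mono1)
  then show ?thesis
    using assms(2) by (auto simp: block_def tuples_def dest: in_set_takeD in_set_dropD)
qed

text \<open>A list of length \<open>K * n\<close> stands for \<open>K\<close> consecutive \<open>n\<close>-tuples, its blocks.\<close>

definition realize_pattern ::
    "('a, 'f, 'r) struct \<Rightarrow> 'a list set \<Rightarrow> nat \<Rightarrow> nat \<Rightarrow> nat \<Rightarrow> nat set \<Rightarrow> 'a list set" where
  "realize_pattern N Y n m K S = {z \<in> tuples (univ N) (K * n).
     \<exists>y \<in> tuples (univ N) m. \<forall>i < K. block n i z @ y \<in> Y \<longleftrightarrow> i \<in> S}"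

definition shattered_blocks ::
    "('a, 'f, 'r) struct \<Rightarrow> 'a list set \<Rightarrow> nat \<Rightarrow> nat \<Rightarrow> nat \<Rightarrow> 'a list set" where
  "shattered_blocks N Y n m K =
     {z \<in> tuples (univ N) (K * n). \<forall>S \<in> Pow {..<K}. z \<in> realize_pattern N Y n m K S}"

lemma definable_realize_pattern:
  assumes Y: "Y \<in> definable L N (n + m) A" and A: "A \<subseteq> univ N"
  shows "realize_pattern N Y n m K S \<in> definable L N (K * n) A"
proof -
  let ?in = "\<lambda>i zy. block n i zy @ drop (K * n) zy \<in> Y"
  have single: "{zy \<in> tuples (univ N) (K * n + m). ?in i zy} \<in> definable L N (K * n + m) A"
    if "i < K" for i
  proof -
    have i: "i * n + n \<le> K * n" using that by (metis Suc_leI add.commute mult_Suc mult_le_mono1)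
    let ?f = "\<lambda>j. if j < n then i * n + j else K * n + (j - n)"
    have D: "{zy \<in> tuples (univ N) (K * n + m). map (\<lambda>j. zy ! ?f j) [0..<n + m] \<in> Y}
        \<in> definable L N (K * n + m) A"
      by (rule definable_reindex[OF Y A]) (use i in auto)
    have "map (\<lambda>j. zy ! ?f j) [0..<n + m] = block n i zy @ drop (K * n) zy"
      if "zy \<in> tuples (univ N) (K * n + m)" for zy
      using that i by (auto simp: list_eq_iff_nth_eq nth_append tuples_def block_def)
    then show ?thesis by (intro member_Collect_cong[OF D]) (simp only:)
  qed
  have "{zy \<in> tuples (univ N) (K * n + m). ?in i zy \<longleftrightarrow> i \<in> S} \<in> definable L N (K * n + m) A"
    if "i < K" for i
    using single[OF that] definable.sets_Collect_neg[OF single[OF that]] by (cases "i \<in> S") simp_all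
  then have D: "{zy \<in> tuples (univ N) (K * n + m). \<forall>i \<in> {..<K}. ?in i zy \<longleftrightarrow> i \<in> S}
      \<in> definable L N (K * n + m) A"
    by (intro definable_Ball) auto
  show ?thesis
    unfolding realize_pattern_def
  proof (rule member_Collect_cong[OF definable_projection[OF D]])
    fix z assume z: "z \<in> tuples (univ N) (K * n)"
    have "z @ y \<in> {zy \<in> tuples (univ N) (K * n + m). \<forall>i \<in> {..<K}. ?in i zy \<longleftrightarrow> i \<in> S}
        \<longleftrightarrow> (\<forall>i < K. block n i z @ y \<in> Y \<longleftrightarrow> i \<in> S)" if "y \<in> tuples (univ N) m" for y
      using tuples_append[OF z that] z by (auto simp: block_append tuples_def)
    then show "(\<exists>y \<in> tuples (univ N) m. z @ y \<in>
          {zy \<in> tuples (univ N) (K * n + m). \<forall>i \<in> {..<K}. ?in i zy \<longleftrightarrow> i \<in> S})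
        \<longleftrightarrow> (\<exists>y \<in> tuples (univ N) m. \<forall>i < K. block n i z @ y \<in> Y \<longleftrightarrow> i \<in> S)"
      by (intro bex_cong) simp_all
  qed
qed

lemma definable_shattered_blocks:
  assumes "Y \<in> definable L N (n + m) A" "A \<subseteq> univ N"
  shows "shattered_blocks N Y n m K \<in> definable L N (K * n) A"
  unfolding shattered_blocks_def
proof (rule definable_Ball)
  show "finite (Pow {..<K})" by simp
next
  fix S assume "S \<in> Pow {..<K}"
  have "{z \<in> tuples (univ N) (K * n). z \<in> realize_pattern N Y n m K S} = realize_pattern N Y n m K S"
    by (auto simp: realize_pattern_def)
  then show "{z \<in> tuples (univ N) (K * n). z \<in> realize_pattern N Y n m K S} \<in> definable L N (K * n) A"
    using definable_realize_pattern[OF assms] by simp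
qed

lemma shattered_blocks_prefix:
  assumes "z @ z' \<in> shattered_blocks N Y n m (K + K')" "length z = K * n"
  shows "z \<in> shattered_blocks N Y n m K"
proof -
  have "z \<in> tuples (univ N) (K * n)"
    using assms by (auto simp: shattered_blocks_def tuples_def)
  moreover have "\<exists>y \<in> tuples (univ N) m. \<forall>i < K. block n i z @ y \<in> Y \<longleftrightarrow> i \<in> S" if "S \<subseteq> {..<K}" for S
  proof -
    have "S \<in> Pow {..<K + K'}" using that by auto
    then obtain y where "y \<in> tuples (univ N) m"
        "\<And>i. i < K + K' \<Longrightarrow> block n i (z @ z') @ y \<in> Y \<longleftrightarrow> i \<in> S"
      using assms(1) unfolding shattered_blocks_def realize_pattern_def by blast
    then show ?thesis using block_append[OF _ assms(2)] by (metis trans_less_add1)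
  qed
  ultimately show ?thesis by (auto simp: shattered_blocks_def realize_pattern_def)
qed

lemma countable_card_less:
  assumes "countable A" "natLeq <o \<kappa>"
  shows "|A| <o \<kappa>"
proof -
  obtain f :: "'a \<Rightarrow> nat" where "inj_on f A" using assms(1) by (auto simp: countable_def)
  then have "|A| \<le>o |UNIV :: nat set|" by (intro card_of_ordLeqI[of f]) auto
  then show ?thesis using card_of_nat assms(2) by (meson ordIso_iff_ordLeq ordLeq_ordLess_trans ordLeq_transitive)
qed

text \<open>
  Saturation one tuple at a time: a finite sequence that can be prolonged to arbitrarily long shattered
  sequences has a next term with the same property, since the conditions on the next term
  weaken as the length asked for decreases.
\<close>

lemma prolong_shattered_blocks:
  assumes sat: "saturated \<kappa> L N" "natLeq <o \<kappa>"
    and Y: "Y \<in> definable L N (n + m) {}"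
    and z: "length z = k * n" "\<And>K. \<exists>z'. z @ z' \<in> shattered_blocks N Y n m (k + K)"
  obtains a where "length a = n" "\<And>K. \<exists>z'. (z @ a) @ z' \<in> shattered_blocks N Y n m (Suc k + K)"
proof -
  define A where "A = set z"
  have zN: "z \<in> tuples (univ N) (k * n)"
    using z(2)[of 0] z(1) by (auto simp: shattered_blocks_def tuples_def)
  then have A: "A \<subseteq> univ N" "z \<in> tuples A (k * n)" by (auto simp: A_def tuples_def)
  define V where "V K = {a \<in> tuples (univ N) n.
    \<exists>z' \<in> tuples (univ N) (K * n). a @ z' \<in> {w \<in> tuples (univ N) (n + K * n).
      z @ w \<in> shattered_blocks N Y n m (Suc k + K)}}" for K
  have V_iff: "a \<in> V K \<longleftrightarrow> (length a = n \<and> (\<exists>z'. (z @ a) @ z' \<in> shattered_blocks N Y n m (Suc k + K)))"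
    for a K
  proof
    assume "a \<in> V K"
    then show "length a = n \<and> (\<exists>z'. (z @ a) @ z' \<in> shattered_blocks N Y n m (Suc k + K))"
      by (auto simp: V_def tuples_def)
  next
    assume "length a = n \<and> (\<exists>z'. (z @ a) @ z' \<in> shattered_blocks N Y n m (Suc k + K))"
    then obtain z' where z': "length a = n" "z @ a @ z' \<in> shattered_blocks N Y n m (Suc k + K)"
      by auto
    then have "z @ a @ z' \<in> tuples (univ N) ((Suc k + K) * n)" by (simp add: shattered_blocks_def)
    then have "a \<in> tuples (univ N) n" "z' \<in> tuples (univ N) (K * n)"
      using z' z(1) by (auto simp: tuples_def algebra_simps)
    then show "a \<in> V K" using z'(2) tuples_append[of a _ n z' "K * n"] by (auto simp: V_def)
  qed
  have "V K \<in> definable L N n A" for K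
  proof -
    have "shattered_blocks N Y n m (Suc k + K) \<in> definable L N ((Suc k + K) * n) A"
      by (rule definable_mono[OF empty_subsetI definable_shattered_blocks[OF Y]]) simp
    moreover have "(Suc k + K) * n = k * n + (n + K * n)" by (simp add: algebra_simps)
    ultimately have "shattered_blocks N Y n m (Suc k + K) \<in> definable L N (k * n + (n + K * n)) A"
      by metis
    then show ?thesis
      unfolding V_def by (rule definable_projection[OF definable_section_front[OF _ A]])
  qed
  then have "range V \<subseteq> definable L N n A" by auto
  moreover have "|A| <o \<kappa>"
    unfolding A_def by (rule countable_card_less[OF _ sat(2)]) (simp add: countable_finite)
  moreover have "\<exists>as \<in> tuples (univ N) n. \<forall>X \<in> \<G>. as \<in> X" if \<G>: "finite \<G>" "\<G> \<subseteq> range V" for \<G>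
  proof -
    obtain J where J: "finite J" "\<G> = V ` J" using finite_subset_image[OF \<G>] by blast
    then obtain K0 where K0: "\<And>K. K \<in> J \<Longrightarrow> K \<le> K0" using finite_nat_set_iff_bounded_le by auto
    obtain w where w: "z @ w \<in> shattered_blocks N Y n m (k + Suc K0)" using z(2) by blast
    then have len: "length w = n + K0 * n" using z(1) by (auto simp: shattered_blocks_def tuples_def algebra_simps)
    define a where "a = take n w"
    have la: "length a = n" using len by (simp add: a_def)
    have "a \<in> V K" if "K \<in> J" for K
    proof -
      define u where "u = take (K * n) (drop n w)"
      have "K * n \<le> K0 * n" using K0[OF that] by simp
      then have "length ((z @ a) @ u) = (Suc k + K) * n"
        using len la z(1) by (simp add: u_def algebra_simps)
      moreover have "((z @ a) @ u) @ drop (K * n) (drop n w) = z @ w"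
        by (simp add: a_def u_def del: drop_drop)
      moreover have "k + Suc K0 = (Suc k + K) + (K0 - K)" using K0[OF that] by simp
      ultimately have "(z @ a) @ u \<in> shattered_blocks N Y n m (Suc k + K)"
        using shattered_blocks_prefix w by metis
      then show ?thesis using V_iff la by blast
    qed
    moreover have "a \<in> tuples (univ N) n"
      using w la by (auto simp: shattered_blocks_def tuples_def a_def dest: in_set_takeD)
    ultimately show ?thesis using J(2) by blast
  qed
  ultimately obtain a where "\<And>X. X \<in> range V \<Longrightarrow> a \<in> X"
    using saturated_definable[OF sat(1) A(1)] by metis
  then have "\<And>K. a \<in> V K" by blast
  then show thesis using that[of a] V_iff by blast
qed

text \<open>
  The sequence obtained by prolonging forever realizes each pattern on each of its finite parts, so by
  saturation, over its countably many entries, all patterns at once.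
\<close>

lemma NIP_bounds_shattered_blocks:
  assumes NIP: "NIP L T" "is_model L T N"
    and sat: "saturated \<kappa> L N" "natLeq <o \<kappa>"
    and Y: "Y \<in> definable L N (n + m) {}"
  shows "\<exists>K. shattered_blocks N Y n m K = {}"
proof (rule ccontr)
  assume "\<nexists>K. shattered_blocks N Y n m K = {}"
  then have start: "\<exists>z'. [] @ z' \<in> shattered_blocks N Y n m (0 + K)" for K by auto
  let ?P = "\<lambda>k z. length z = k * n \<and> (\<forall>K. \<exists>z'. z @ z' \<in> shattered_blocks N Y n m (k + K))"
  have "\<exists>f. \<forall>k. ?P k (f k) \<and> (\<exists>a. length a = n \<and> f (Suc k) = f k @ a)"
  proof (rule dependent_nat_choice)
    show "\<exists>z. ?P 0 z" using start by (intro exI[of _ "[]"]) simp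
  next
    fix z k assume "?P k z"
    then obtain a where "length a = n" "\<And>K. \<exists>z'. (z @ a) @ z' \<in> shattered_blocks N Y n m (Suc k + K)"
      using prolong_shattered_blocks[OF sat Y, of z k] by metis
    then show "\<exists>w. ?P (Suc k) w \<and> (\<exists>a. length a = n \<and> w = z @ a)"
      using \<open>?P k z\<close> by (intro exI[of _ "z @ a"]) auto
  qed
  then obtain f where P: "\<And>k. ?P k (f k)" and step: "\<And>k. \<exists>a. length a = n \<and> f (Suc k) = f k @ a"
    by blast
  have shat: "f K \<in> shattered_blocks N Y n m K" for K
    using P[of K] shattered_blocks_prefix[of "f K" _ N Y n m K 0] by (metis add.right_neutral)
  define a where "a i = block n i (f (Suc i))" for i
  have block: "block n i (f k) = a i" if "i < k" for i k
    using that
  proof (induction k)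
    case (Suc k)
    show ?case
    proof (cases "i = k")
      case False
      then have "i < k" using Suc.prems by simp
      obtain b where "f (Suc k) = f k @ b" using step by blast
      then show ?thesis using Suc.IH[OF \<open>i < k\<close>] block_append[OF \<open>i < k\<close>, of "f k" n] P[of k] by simp
    qed (simp add: a_def)
  qed simp
  have aN: "a i \<in> tuples (univ N) n" for i
    unfolding a_def using shat[of "Suc i"]
    by (intro block_in_tuples[of i "Suc i"]) (auto simp: shattered_blocks_def)
  have finite_pattern: "\<exists>y \<in> tuples (univ N) m. \<forall>i < K. a i @ y \<in> Y \<longleftrightarrow> i \<in> S" if "S \<subseteq> {..<K}" for K S
    using shat[of K] that block unfolding shattered_blocks_def realize_pattern_def by force
  have "a i \<noteq> a j" if "i < j" for i j
  proof -
    have "{i} \<subseteq> {..<Suc j}" using that by simp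
    then show ?thesis using finite_pattern[of "{i}" "Suc j"] that
      by (metis insertI1 less_Suc_eq less_irrefl singletonD)
  qed
  then have "inj a" by (metis injI nat_neq_iff)
  then have inf: "infinite (range a)" by (rule range_inj_infinite)
  define A where "A = (\<Union>i. set (a i))"
  have A: "A \<subseteq> univ N" "a i \<in> tuples A n" for i
    using aN by (auto simp: A_def tuples_def)
  have small: "|A| <o \<kappa>"
    unfolding A_def by (rule countable_card_less[OF _ sat(2)]) (simp add: countable_finite)
  have infinite_pattern: "\<exists>y \<in> tuples (univ N) m. \<forall>i. a i @ y \<in> Y \<longleftrightarrow> a i \<in> I" for I
  proof -
    define V where "V i = {y \<in> tuples (univ N) m. a i @ y \<in> Y \<longleftrightarrow> a i \<in> I}" for i
    have "V i \<in> definable L N m A" for i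
    proof -
      have "{y \<in> tuples (univ N) m. a i @ y \<in> Y} \<in> definable L N m A"
        by (rule definable_section_front[OF definable_mono[OF empty_subsetI Y] A])
      from this definable.sets_Collect_neg[OF this] show ?thesis
        unfolding V_def by (cases "a i \<in> I") simp_all
    qed
    then have "range V \<subseteq> definable L N m A" by auto
    moreover have "\<exists>y \<in> tuples (univ N) m. \<forall>X \<in> \<G>. y \<in> X" if \<G>: "finite \<G>" "\<G> \<subseteq> range V" for \<G>
    proof -
      obtain J where J: "finite J" "\<G> = V ` J" using finite_subset_image[OF \<G>] by blast
      then obtain K where K: "\<And>i. i \<in> J \<Longrightarrow> i < K" using finite_nat_set_iff_bounded by auto
      obtain y where "y \<in> tuples (univ N) m" "\<And>i. i < K \<Longrightarrow> a i @ y \<in> Y \<longleftrightarrow> i \<in> {i. i < K \<and> a i \<in> I}"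
        using finite_pattern[of "{i. i < K \<and> a i \<in> I}" K] by auto
      then show ?thesis using J(2) K by (intro bexI[of _ y]) (auto simp: V_def)
    qed
    ultimately obtain y where "y \<in> tuples (univ N) m" "\<And>X. X \<in> range V \<Longrightarrow> y \<in> X"
      using saturated_definable[OF sat(1) A(1) small] by metis
    then show ?thesis by (intro bexI[of _ y]) (auto simp: V_def)
  qed
  obtain \<phi> where \<phi>: "\<phi> \<in> formulas L (n + m) {}" "Y = solutions N (n + m) \<phi>"
    using Y by (auto simp: definable_def)
  have "shattered N \<phi> m (range a)"
    unfolding shattered_def
  proof (intro allI impI)
    fix I assume "I \<subseteq> range a"
    obtain y where y: "y \<in> tuples (univ N) m" "\<And>i. a i @ y \<in> Y \<longleftrightarrow> a i \<in> I"
      using infinite_pattern[of I] by blast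
    have "holds N \<phi> (a i @ y) \<longleftrightarrow> a i @ y \<in> Y" for i
      using tuples_append[OF aN y(1)] by (auto simp: \<phi>(2) solutions_def)
    then show "\<exists>y \<in> tuples (univ N) m. \<forall>x \<in> range a. holds N \<phi> (x @ y) \<longleftrightarrow> x \<in> I"
      using y by (intro bexI[of _ y]) auto
  qed
  moreover have "range a \<subseteq> tuples (univ N) n" using aN by auto
  ultimately show False using NIP \<phi>(1) inf unfolding NIP_def by blast
qed

section \<open>Measures that are finitely satisfiable in a submodel\<close>

definition fibre :: "('a, 'f, 'r) struct \<Rightarrow> nat \<Rightarrow> 'a list set \<Rightarrow> 'a list \<Rightarrow> 'a list set" where
  "fibre N n Y b = {a \<in> tuples (univ N) n. a @ b \<in> Y}"

lemma definable_fibre: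
  "Y \<in> definable L N (n + k) A \<Longrightarrow> A \<subseteq> univ N \<Longrightarrow> b \<in> tuples A k \<Longrightarrow> fibre N n Y b \<in> definable L N n A"
  unfolding fibre_def by (rule definable_section)

lemma (in charge) m_le_sum:
  assumes "finite I" "X \<in> \<A>" "\<And>i. i \<in> I \<Longrightarrow> Y i \<in> \<A>" "X \<subseteq> (\<Union>i\<in>I. Y i)"
  shows "m X \<le> (\<Sum>i\<in>I. m (X \<inter> Y i))"
  using assms
proof (induction I arbitrary: X rule: finite_induct)
  case empty
  then show ?case using m_empty by simp
next
  case (insert i I)
  have "m (X - Y i) \<le> (\<Sum>j\<in>I. m ((X - Y i) \<inter> Y j))"
    using insert.prems by (intro insert.IH) auto
  also have "\<dots> \<le> (\<Sum>j\<in>I. m (X \<inter> Y j))"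
    using insert.prems by (intro sum_mono m_mono) auto
  finally show ?case using m_split[of X "Y i"] insert by simp
qed

text \<open>
  The ambient model is \<open>U\<close>, the measure lives on the sets definable over \<open>A\<close>, and \<open>M\<close> is the universe
  of an elementary submodel, given through the Tarski-Vaught property, in which the measure is
  finitely satisfiable.
\<close>

locale finitely_satisfied_charge = charge "tuples (univ U) n" "definable L U n A" \<mu>
  for L :: "('f, 'r) lang" and U :: "('a, 'f, 'r) struct" and n :: nat and A :: "'a set"
    and \<mu> :: "'a list set \<Rightarrow> real" +
  fixes M :: "'a set"
  assumes M_A: "M \<subseteq> A" and A_U: "A \<subseteq> univ U"
    and tarski_vaught: "X \<in> definable L U k M \<Longrightarrow> X \<noteq> {} \<Longrightarrow> X \<inter> tuples M k \<noteq> {}"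
    and fin_sat: "X \<in> definable L U n A \<Longrightarrow> 0 < \<mu> X \<Longrightarrow> X \<inter> tuples M n \<noteq> {}"
begin

lemma M_U: "M \<subseteq> univ U"
  using M_A A_U by blast

lemma over_A: "X \<in> definable L U k M \<Longrightarrow> X \<in> definable L U k A"
  by (rule definable_mono[OF M_A])

lemma measure_mono_on_M:
  assumes "X \<in> definable L U n A" "Y \<in> definable L U n A" "X \<inter> tuples M n \<subseteq> Y"
  shows "\<mu> X \<le> \<mu> Y"
proof -
  have "(X - Y) \<inter> tuples M n = {}" using assms(3) by blast
  then have "\<not> 0 < \<mu> (X - Y)" using fin_sat[of "X - Y"] assms by auto
  then have "\<mu> X \<le> \<mu> (X \<inter> Y)" using m_split[OF assms(1,2)] by linarith
  also have "\<dots> \<le> \<mu> Y" using assms by (intro m_mono) auto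
  finally show ?thesis .
qed

text \<open>
  One point of \<open>M\<close> in each atom of positive measure of the algebra generated by \<open>\<Theta>\<close>, with
  the measure of the atom as its weight, computes \<open>\<mu>\<close> exactly on \<open>\<Theta>\<close>.
\<close>

lemma weighted_points_within:
  assumes "finite \<Theta>" "\<Theta> \<subseteq> definable L U n A" "X \<in> definable L U n A"
  shows "\<exists>S w. finite S \<and> S \<subseteq> X \<inter> tuples M n \<and> (\<forall>a \<in> S. 0 \<le> w a) \<and> sum w S = \<mu> X \<and>
    (\<forall>Y \<in> \<Theta>. \<mu> (X \<inter> Y) = sum w (S \<inter> Y))"
  using assms
proof (induction \<Theta> arbitrary: X rule: finite_induct)
  case empty
  show ?case
  proof (cases "0 < \<mu> X")
    case True
    then obtain a where "a \<in> X \<inter> tuples M n" using fin_sat empty.prems by blast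
    then show ?thesis using True by (intro exI[of _ "{a}"] exI[of _ "\<lambda>_. \<mu> X"]) auto
  next
    case False
    then have "\<mu> X = 0" using nonneg[OF empty.prems(2)] by simp
    then show ?thesis by (intro exI[of _ "{}"]) auto
  qed
next
  case (insert Z \<Theta>)
  have Z: "Z \<in> definable L U n A" and \<Theta>: "\<Theta> \<subseteq> definable L U n A" using insert.prems by auto
  have X: "X \<inter> Z \<in> definable L U n A" "X - Z \<in> definable L U n A" using insert.prems Z by auto
  obtain S v where S: "finite S" "S \<subseteq> (X \<inter> Z) \<inter> tuples M n" "\<forall>a \<in> S. 0 \<le> v a"
      "sum v S = \<mu> (X \<inter> Z)" "\<forall>Y \<in> \<Theta>. \<mu> (X \<inter> Z \<inter> Y) = sum v (S \<inter> Y)"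
    using insert.IH[OF \<Theta> X(1)] by blast
  obtain R u where R: "finite R" "R \<subseteq> (X - Z) \<inter> tuples M n" "\<forall>a \<in> R. 0 \<le> u a"
      "sum u R = \<mu> (X - Z)" "\<forall>Y \<in> \<Theta>. \<mu> ((X - Z) \<inter> Y) = sum u (R \<inter> Y)"
    using insert.IH[OF \<Theta> X(2)] by blast
  define w where "w a = (if a \<in> Z then v a else u a)" for a
  have SR: "S \<subseteq> Z" "R \<inter> Z = {}" "S \<inter> R = {}" using S(2) R(2) by auto
  have w: "sum w ((S \<union> R) \<inter> Y) = sum v (S \<inter> Y) + sum u (R \<inter> Y)" for Y
  proof -
    have "(S \<union> R) \<inter> Y = (S \<inter> Y) \<union> (R \<inter> Y)" by blast
    then have "sum w ((S \<union> R) \<inter> Y) = sum w (S \<inter> Y) + sum w (R \<inter> Y)"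
      using S(1) R(1) SR(3) by (simp add: sum.union_disjoint disjoint_iff)
    moreover have "sum w (S \<inter> Y) = sum v (S \<inter> Y)"
      using SR(1) by (intro sum.cong) (auto simp: w_def)
    moreover have "sum w (R \<inter> Y) = sum u (R \<inter> Y)"
      using SR(2) by (intro sum.cong) (auto simp: w_def)
    ultimately show ?thesis by simp
  qed
  have "sum w (S \<union> R) = \<mu> X"
    using w[of UNIV] S(4) R(4) m_split[OF insert.prems(2) Z] by simp
  moreover have "\<mu> (X \<inter> Y) = sum w ((S \<union> R) \<inter> Y)" if "Y \<in> insert Z \<Theta>" for Y
  proof (cases "Y = Z")
    case True
    have "S \<inter> Z = S" using SR(1) by blast
    then show ?thesis using w[of Z] True S(4) SR(2) by simp
  next
    case False
    then have Y: "Y \<in> \<Theta>" using that by simp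
    then have "\<mu> (X \<inter> Y) = \<mu> ((X \<inter> Y) \<inter> Z) + \<mu> ((X \<inter> Y) - Z)"
      using \<Theta> Z insert.prems(2) by (intro m_split) auto
    moreover have "(X \<inter> Y) \<inter> Z = X \<inter> Z \<inter> Y" "(X \<inter> Y) - Z = (X - Z) \<inter> Y" by auto
    ultimately show ?thesis using S(5) R(5) Y w[of Y] by simp
  qed
  moreover have "\<forall>a \<in> S \<union> R. 0 \<le> w a" using S(3) R(3) SR by (auto simp: w_def)
  moreover have "finite (S \<union> R)" "S \<union> R \<subseteq> X \<inter> tuples M n" using S R by auto
  ultimately show ?case by blast
qed

lemma weighted_points:
  assumes "finite \<Theta>" "\<Theta> \<subseteq> definable L U n A"
  obtains S w where "finite S" "S \<subseteq> tuples M n" "\<And>a. a \<in> S \<Longrightarrow> 0 \<le> w a"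
    "\<And>Y. Y \<in> \<Theta> \<Longrightarrow> \<mu> Y = sum w (S \<inter> Y)"
proof -
  obtain S w where S: "finite S" "S \<subseteq> tuples (univ U) n \<inter> tuples M n" "\<forall>a \<in> S. 0 \<le> w a"
      "\<forall>Y \<in> \<Theta>. \<mu> (tuples (univ U) n \<inter> Y) = sum w (S \<inter> Y)"
    using weighted_points_within[OF assms top] by blast
  have "tuples (univ U) n \<inter> Y = Y" if "Y \<in> \<Theta>" for Y
    using sets_into_space[of Y] that assms(2) by blast
  then show thesis using that[of S w] S by auto
qed

end

text \<open>
  What smoothness of the measure on the pair of models provides: finitely many sets definable over \<open>A\<close>
  approximate all fibres of a definable set from inside and from outside.  The inclusions only hold
  between traces on \<open>M\<close>, which is enough to compare measures because \<open>\<mu>\<close> does not see the rest.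
\<close>

locale uniformly_sandwiched_charge = finitely_satisfied_charge L U n A \<mu> M
  for L :: "('f, 'r) lang" and U :: "('a, 'f, 'r) struct" and n A \<mu> M +
  assumes sandwich: "Y \<in> definable L U (n + k) {} \<Longrightarrow> 0 < \<epsilon> \<Longrightarrow>
    \<exists>\<Theta>. finite \<Theta> \<and>
      (\<forall>(X0, X1) \<in> \<Theta>. X0 \<in> definable L U n A \<and> X1 \<in> definable L U n A \<and> \<mu> X1 - \<mu> X0 < \<epsilon>) \<and>
      (\<forall>b \<in> tuples (univ U) k. \<exists>(X0, X1) \<in> \<Theta>.
         X0 \<inter> tuples M n \<subseteq> fibre U n Y b \<and> fibre U n Y b \<inter> tuples M n \<subseteq> X1)"
begin

text \<open>
  Points of \<open>M\<close> that give the finitely many approximating sets their exact measure are good for all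
  fibres at once.
\<close>

lemma finite_approximation:
  assumes Y: "Y \<in> definable L U (n + k) {}" and "0 < \<epsilon>"
  shows "\<exists>S w. finite S \<and> S \<subseteq> tuples M n \<and> (\<forall>a \<in> S. 0 \<le> w a) \<and>
    (\<forall>b \<in> tuples A k. \<bar>\<mu> (fibre U n Y b) - sum w (S \<inter> fibre U n Y b)\<bar> < \<epsilon>)"
proof -
  obtain \<Theta> where \<Theta>: "finite \<Theta>"
      "\<And>X0 X1. (X0, X1) \<in> \<Theta> \<Longrightarrow> X0 \<in> definable L U n A \<and> X1 \<in> definable L U n A \<and> \<mu> X1 - \<mu> X0 < \<epsilon>"
      "\<And>b. b \<in> tuples (univ U) k \<Longrightarrow> \<exists>(X0, X1) \<in> \<Theta>.
         X0 \<inter> tuples M n \<subseteq> fibre U n Y b \<and> fibre U n Y b \<inter> tuples M n \<subseteq> X1"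
    using sandwich[OF Y \<open>0 < \<epsilon>\<close>] by (auto split: prod.splits)
  have "finite (fst ` \<Theta> \<union> snd ` \<Theta>)" "fst ` \<Theta> \<union> snd ` \<Theta> \<subseteq> definable L U n A"
    using \<Theta>(1,2) by auto
  then obtain S w where S: "finite S" "S \<subseteq> tuples M n" "\<And>a. a \<in> S \<Longrightarrow> 0 \<le> w a"
      "\<And>Y. Y \<in> fst ` \<Theta> \<union> snd ` \<Theta> \<Longrightarrow> \<mu> Y = sum w (S \<inter> Y)"
    using weighted_points by metis
  have "\<bar>\<mu> (fibre U n Y b) - sum w (S \<inter> fibre U n Y b)\<bar> < \<epsilon>" if b: "b \<in> tuples A k" for b
  proof -
    let ?F = "fibre U n Y b"
    obtain X0 X1 where X: "(X0, X1) \<in> \<Theta>" "X0 \<inter> tuples M n \<subseteq> ?F" "?F \<inter> tuples M n \<subseteq> X1"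
      using \<Theta>(3)[OF tuples_mono[OF A_U b]] by blast
    have F: "?F \<in> definable L U n A"
      by (rule definable_fibre[OF definable_mono[OF empty_subsetI Y] A_U b])
    have "\<mu> X0 \<le> \<mu> ?F" "\<mu> ?F \<le> \<mu> X1"
      using measure_mono_on_M \<Theta>(2)[OF X(1)] F X(2,3) by auto
    moreover have "sum w (S \<inter> X0) \<le> sum w (S \<inter> ?F)" "sum w (S \<inter> ?F) \<le> sum w (S \<inter> X1)"
      using S(1-3) X(2,3) by (auto intro!: sum_mono2)
    moreover have "\<mu> X0 = sum w (S \<inter> X0)" "\<mu> X1 = sum w (S \<inter> X1)"
      using S(4) X(1) by force+
    moreover have "\<mu> X1 - \<mu> X0 < \<epsilon>" using \<Theta>(2)[OF X(1)] by simp
    ultimately show ?thesis by linarith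
  qed
  then show ?thesis using S(1-3) by (intro exI[of _ S] exI[of _ w]) auto
qed

text \<open>
  The weighted points of \<open>M\<close> make \<open>\<mu>\<close> definable over \<open>M\<close> up to a factor 2: having large measure is
  replaced by containing points of large total weight, which is a finite disjunction.
\<close>

lemma large_fibres_definable:
  assumes \<Psi>: "\<Psi> \<in> definable L U (n + k) M" and "0 < r"
  obtains D where "D \<in> definable L U k M"
    "\<And>c. c \<in> tuples M k \<Longrightarrow> 2 * r \<le> \<mu> (fibre U n \<Psi> c) \<Longrightarrow> c \<in> D"
    "\<And>c. c \<in> tuples M k \<Longrightarrow> c \<in> D \<Longrightarrow> r \<le> \<mu> (fibre U n \<Psi> c)"
proof -
  obtain l d Y where d: "d \<in> tuples M l" and "Y \<in> definable L U (n + k + l) {}"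
    and \<Psi>Y: "\<Psi> = {as \<in> tuples (univ U) (n + k). as @ d \<in> Y}"
    using definable_parameters[OF \<Psi> M_U] .
  then have Y: "Y \<in> definable L U (n + (k + l)) {}" by (simp add: add.assoc)
  have fibre: "fibre U n \<Psi> c = fibre U n Y (c @ d)" if "c \<in> tuples M k" for c
    using tuples_append[OF _ tuples_mono[OF M_U that]] by (auto simp: fibre_def \<Psi>Y)
  \<comment> \<open>The threshold \<open>3 / 2 * r\<close> used below lies midway between \<open>r\<close> and \<open>2 * r\<close>, with room \<open>r / 2\<close> for the error.\<close>
  have "0 < r / 2" using \<open>0 < r\<close> by simp
  obtain S w where S: "finite S" "S \<subseteq> tuples M n" "\<forall>a \<in> S. 0 \<le> w a"
      "\<forall>b \<in> tuples A (k + l). \<bar>\<mu> (fibre U n Y b) - sum w (S \<inter> fibre U n Y b)\<bar> < r / 2"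
    using finite_approximation[OF Y \<open>0 < r / 2\<close>] by blast
  define D where "D = {c \<in> tuples (univ U) k.
    \<exists>B \<in> {B \<in> Pow S. 3 / 2 * r \<le> sum w B}. \<forall>a \<in> B. a @ c \<in> \<Psi>}"
  have D: "D \<in> definable L U k M"
    unfolding D_def
  proof (rule definable.sets_Collect_finite_Ex)
    show "finite {B \<in> Pow S. 3 / 2 * r \<le> sum w B}" using S(1) by simp
    fix B assume "B \<in> {B \<in> Pow S. 3 / 2 * r \<le> sum w B}"
    then have B: "B \<subseteq> S" by simp
    show "{c \<in> tuples (univ U) k. \<forall>a \<in> B. a @ c \<in> \<Psi>} \<in> definable L U k M"
    proof (rule definable_Ball)
      show "finite B" by (rule finite_subset[OF B S(1)])
      show "{c \<in> tuples (univ U) k. a @ c \<in> \<Psi>} \<in> definable L U k M" if "a \<in> B" for a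
        by (rule definable_section_front[OF \<Psi> M_U]) (use B S(2) that in blast)
    qed
  qed
  have D_iff: "c \<in> D \<longleftrightarrow> 3 / 2 * r \<le> sum w (S \<inter> fibre U n \<Psi> c)" if "c \<in> tuples M k" for c
  proof
    assume "c \<in> D"
    then obtain B where B: "B \<subseteq> S" "3 / 2 * r \<le> sum w B" "\<forall>a \<in> B. a @ c \<in> \<Psi>"
      by (auto simp: D_def)
    have "a \<in> tuples (univ U) n" if "a \<in> S" for a using S(2) that tuples_mono[OF M_U] by blast
    then have "B \<subseteq> S \<inter> fibre U n \<Psi> c" using B by (auto simp: fibre_def)
    then have "sum w B \<le> sum w (S \<inter> fibre U n \<Psi> c)" using S(1,3) by (intro sum_mono2) auto
    then show "3 / 2 * r \<le> sum w (S \<inter> fibre U n \<Psi> c)" using B(2) by linarith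
  next
    assume "3 / 2 * r \<le> sum w (S \<inter> fibre U n \<Psi> c)"
    then have "S \<inter> fibre U n \<Psi> c \<in> {B \<in> Pow S. 3 / 2 * r \<le> sum w B}" by simp
    moreover have "\<forall>a \<in> S \<inter> fibre U n \<Psi> c. a @ c \<in> \<Psi>" by (simp add: fibre_def)
    ultimately show "c \<in> D" unfolding D_def using tuples_mono[OF M_U that] by blast
  qed
  have approx: "\<bar>\<mu> (fibre U n \<Psi> c) - sum w (S \<inter> fibre U n \<Psi> c)\<bar> < r / 2" if "c \<in> tuples M k" for c
    using S(4)[rule_format, OF tuples_append[OF tuples_mono[OF M_A that] tuples_mono[OF M_A d]]] fibre[OF that] by simp
  show thesis
  proof (rule that[OF D])
    fix c assume "c \<in> tuples M k"
    note c = D_iff[OF this] approx[OF this]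
    show "2 * r \<le> \<mu> (fibre U n \<Psi> c) \<Longrightarrow> c \<in> D" using c by linarith
    show "c \<in> D \<Longrightarrow> r \<le> \<mu> (fibre U n \<Psi> c)" using c by linarith
  qed
qed

text \<open>
  Induction on the number of blocks, eliminating the block in front.  By the pigeonhole principle, for
  any choice of the remaining blocks one of the relations, which cover everything, has a fibre
  that occupies at least the fraction \<open>1 / card I\<close> of \<open>R\<close>.  This is a definable condition on the
  remaining blocks, up to the factor 2, so the induction hypothesis applies to these conditions.
  The fibre found is too large to avoid \<open>X\<close> or its complement, which leaves the choice whether the
  block put in front lies in \<open>X\<close>.  The set \<open>R\<close> does not change during the induction because the
  number of relations does not.
\<close>

lemma prescribed_signs:
  assumes I: "finite I" "I \<noteq> {}" and R: "R \<in> definable L U n M" "\<rho> \<le> \<mu> R" "0 < \<rho>"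
    and split: "\<And>W. W \<in> definable L U n M \<Longrightarrow> W \<subseteq> R \<Longrightarrow> \<rho> / (2 * card I) \<le> \<mu> W \<Longrightarrow>
      W \<inter> tuples M n \<inter> X \<noteq> {} \<and> W \<inter> tuples M n - X \<noteq> {}"
    and \<Psi>: "\<And>i. i \<in> I \<Longrightarrow> \<Psi> i \<in> definable L U (k * n) M"
    and cover: "\<And>z. z \<in> tuples M (k * n) \<Longrightarrow> \<exists>i \<in> I. z \<in> \<Psi> i"
  shows "\<exists>i \<in> I. \<exists>z \<in> tuples M (k * n) \<inter> \<Psi> i. \<forall>j < k. block n j z \<in> X \<longleftrightarrow> \<tau> i j"
  using \<Psi> cover
proof (induction k arbitrary: \<Psi> \<tau>)
  case 0
  have "[] \<in> tuples M (0 * n)" by (simp add: tuples_def)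
  then show ?case using 0(2) by fastforce
next
  case (Suc k)
  have cardI: "0 < card I" using I by (simp add: card_gt_0_iff)
  define \<Phi> where "\<Phi> i = {as \<in> tuples (univ U) (n + k * n). take n as \<in> R} \<inter> \<Psi> i" for i
  have \<Psi>': "\<Psi> i \<in> definable L U (n + k * n) M" if "i \<in> I" for i
    using Suc.prems(1)[OF that] by simp
  have \<Phi>: "\<Phi> i \<in> definable L U (n + k * n) M" if "i \<in> I" for i
    unfolding \<Phi>_def using \<Psi>'[OF that] definable_cylinder[OF R(1) M_U] by auto
  have fibre_\<Phi>: "fibre U n (\<Phi> i) c = R \<inter> fibre U n (\<Psi> i) c" if "c \<in> tuples M (k * n)" for i c
    using tuples_append[OF _ tuples_mono[OF M_U that]] definable.sets_into_space[OF R(1)]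
    by (auto simp: fibre_def \<Phi>_def tuples_def)
  have "0 < \<rho> / (2 * card I)" using R(3) cardI by simp
  then have "\<exists>D. D \<in> definable L U (k * n) M \<and>
      (\<forall>c \<in> tuples M (k * n). 2 * (\<rho> / (2 * card I)) \<le> \<mu> (fibre U n (\<Phi> i) c) \<longrightarrow> c \<in> D) \<and>
      (\<forall>c \<in> tuples M (k * n). c \<in> D \<longrightarrow> \<rho> / (2 * card I) \<le> \<mu> (fibre U n (\<Phi> i) c))" if "i \<in> I" for i
    using large_fibres_definable[OF \<Phi>[OF that]] by metis
  then obtain D where D: "\<And>i. i \<in> I \<Longrightarrow> D i \<in> definable L U (k * n) M"
      "\<And>i c. i \<in> I \<Longrightarrow> c \<in> tuples M (k * n) \<Longrightarrow>
        2 * (\<rho> / (2 * card I)) \<le> \<mu> (fibre U n (\<Phi> i) c) \<Longrightarrow> c \<in> D i"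
      "\<And>i c. i \<in> I \<Longrightarrow> c \<in> tuples M (k * n) \<Longrightarrow> c \<in> D i \<Longrightarrow>
        \<rho> / (2 * card I) \<le> \<mu> (fibre U n (\<Phi> i) c)"
    by metis
  have "\<exists>i \<in> I. c \<in> D i" if c: "c \<in> tuples M (k * n)" for c
  proof (rule ccontr)
    assume not: "\<not> (\<exists>i \<in> I. c \<in> D i)"
    have F: "fibre U n (\<Psi> i) c \<in> definable L U n M" if "i \<in> I" for i
      by (rule definable_fibre[OF \<Psi>'[OF that] M_U c])
    have "R - (\<Union>i\<in>I. fibre U n (\<Psi> i) c) \<in> definable L U n M"
      using R(1) F I by (intro definable.Diff definable.finite_UN) auto
    moreover have "(R - (\<Union>i\<in>I. fibre U n (\<Psi> i) c)) \<inter> tuples M n = {}"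
    proof -
      have "a \<in> (\<Union>i\<in>I. fibre U n (\<Psi> i) c)" if a: "a \<in> tuples M n" for a
      proof -
        have "a @ c \<in> tuples M (Suc k * n)" using tuples_append[OF a c] by simp
        then show ?thesis using Suc.prems(2) tuples_mono[OF M_U a] by (auto simp: fibre_def)
      qed
      then show ?thesis by blast
    qed
    ultimately have "R \<subseteq> (\<Union>i\<in>I. fibre U n (\<Psi> i) c)" using tarski_vaught by blast
    then have "\<mu> R \<le> (\<Sum>i\<in>I. \<mu> (R \<inter> fibre U n (\<Psi> i) c))"
      using F R(1) by (intro m_le_sum[OF I(1)] over_A) auto
    also have "\<dots> < (\<Sum>i\<in>I. \<rho> / card I)"
    proof (rule sum_strict_mono[OF I])
      fix i assume "i \<in> I"
      then have "\<not> 2 * (\<rho> / (2 * card I)) \<le> \<mu> (fibre U n (\<Phi> i) c)"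
        using D(2) c not by blast
      then show "\<mu> (R \<inter> fibre U n (\<Psi> i) c) < \<rho> / card I"
        using fibre_\<Phi>[OF c] by simp
    qed
    also have "\<dots> = \<rho>" using cardI by simp
    finally show False using R(2) by simp
  qed
  from Suc.IH[of D "\<lambda>i j. \<tau> i (Suc j)", OF D(1) this]
  obtain i c where i: "i \<in> I" and c: "c \<in> tuples M (k * n)" "c \<in> D i"
    and signs: "\<forall>j < k. block n j c \<in> X \<longleftrightarrow> \<tau> i (Suc j)" by blast
  have "fibre U n (\<Phi> i) c \<inter> tuples M n \<inter> X \<noteq> {} \<and> fibre U n (\<Phi> i) c \<inter> tuples M n - X \<noteq> {}"
    using D(3)[OF i c] definable_fibre[OF \<Phi>[OF i] M_U c(1)] fibre_\<Phi>[OF c(1), of i]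
    by (intro split) auto
  then obtain a where a: "a \<in> fibre U n (\<Phi> i) c" "a \<in> tuples M n" "a \<in> X \<longleftrightarrow> \<tau> i 0" by blast
  have len: "length a = n" using a(2) by (simp add: tuples_def)
  have "a @ c \<in> tuples M (Suc k * n)" using tuples_append[OF a(2) c(1)] by simp
  moreover have "a @ c \<in> \<Psi> i" using a(1) by (simp add: fibre_def \<Phi>_def)
  moreover have "block n j (a @ c) \<in> X \<longleftrightarrow> \<tau> i j" if "j < Suc k" for j
  proof (cases j)
    case 0
    then show ?thesis using a(3) len by (simp add: block_def)
  next
    case (Suc j')
    then show ?thesis using signs that len by (simp add: block_Suc)
  qed
  ultimately show ?case using i by blast
qed

end

section \<open>From sets definable over the large model to sets definable over the submodel\<close>

lemma near_maximum:
  fixes S :: "real set"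
  assumes "S \<noteq> {}" "bdd_above S" "0 < \<eta>"
  shows "\<exists>x \<in> S. \<forall>y \<in> S. y < x + \<eta>"
proof -
  obtain x where "x \<in> S" "Sup S - \<eta> < x" using less_cSupD[OF assms(1), of "Sup S - \<eta>"] assms(3) by auto
  moreover have "y \<le> Sup S" if "y \<in> S" for y using cSup_upper[OF that assms(2)] .
  ultimately show ?thesis by (intro bexI[of _ x]) force+
qed

context uniformly_sandwiched_charge
begin

lemma largest_inner_set:
  assumes "0 < \<eta>"
  obtains Z where "Z \<in> definable L U n M" "Z \<inter> tuples M n \<subseteq> X"
    "\<And>W. W \<in> definable L U n M \<Longrightarrow> W \<inter> tuples M n \<subseteq> X \<Longrightarrow> \<mu> W < \<mu> Z + \<eta>"
proof -
  let ?S = "\<mu> ` {Z \<in> definable L U n M. Z \<inter> tuples M n \<subseteq> X}"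
  have "{} \<in> {Z \<in> definable L U n M. Z \<inter> tuples M n \<subseteq> X}" by simp
  then have "?S \<noteq> {}" by blast
  moreover have "bdd_above ?S" using m_le_1[OF over_A] by (intro bdd_aboveI2[where M = 1]) auto
  ultimately have "\<exists>x \<in> ?S. \<forall>y \<in> ?S. y < x + \<eta>"
    by (rule near_maximum[OF _ _ assms])
  then show thesis using that by auto
qed

text \<open>
  Remove from the space nearly maximal sets, definable over \<open>M\<close>, that lie within \<open>X\<close> and within its
  complement as far as points of \<open>M\<close> can see.  If the approximation of \<open>X\<close> from inside failed, the
  rest would have measure at least \<open>\<epsilon>\<close>, while each of its non-negligible definable subsets
  contains points of \<open>M\<close> on both sides of \<open>X\<close>, by maximality.  With signs prescribed
  freely, this produces a tuple omitting a pattern that the parameters of \<open>X\<close> realize.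
\<close>

lemma inner_approximation:
  assumes NIP: "\<And>k Y. Y \<in> definable L U (n + k) {} \<Longrightarrow> \<exists>K. shattered_blocks U Y n k K = {}"
    and X: "X \<in> definable L U n A" and "0 < \<epsilon>"
  shows "\<exists>Z \<in> definable L U n M. Z \<inter> tuples M n \<subseteq> X \<and> \<mu> X - \<mu> Z < \<epsilon>"
proof (rule ccontr)
  assume far: "\<not> ?thesis"
  obtain k d Y where d: "d \<in> tuples A k" and Y: "Y \<in> definable L U (n + k) {}"
    and XY: "X = {a \<in> tuples (univ U) n. a @ d \<in> Y}"
    using definable_parameters[OF X A_U] .
  obtain K where K: "shattered_blocks U Y n k K = {}" using NIP[OF Y] by blast
  define I where "I = Pow {..<K}"
  have I: "finite I" "I \<noteq> {}" by (auto simp: I_def)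
  have cardI: "0 < card I" using I by (simp add: card_gt_0_iff)
  \<comment> \<open>The patterns are the relations of \<open>prescribed_signs\<close>, so \<open>\<eta>\<close> is the size that its hypothesis calls large.\<close>
  define \<eta> where "\<eta> = \<epsilon> / (2 * card I)"
  have \<eta>: "0 < \<eta>" using \<open>0 < \<epsilon>\<close> cardI by (simp add: \<eta>_def)
  let ?\<Omega> = "tuples (univ U) n"
  obtain Z0 where Z0: "Z0 \<in> definable L U n M" "Z0 \<inter> tuples M n \<subseteq> X"
    "\<And>W. W \<in> definable L U n M \<Longrightarrow> W \<inter> tuples M n \<subseteq> X \<Longrightarrow> \<mu> W < \<mu> Z0 + \<eta>"
    using largest_inner_set[OF \<eta>, of X] by blast
  obtain Z1 where Z1: "Z1 \<in> definable L U n M" "Z1 \<inter> tuples M n \<subseteq> ?\<Omega> - X"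
    "\<And>W. W \<in> definable L U n M \<Longrightarrow> W \<inter> tuples M n \<subseteq> ?\<Omega> - X \<Longrightarrow> \<mu> W < \<mu> Z1 + \<eta>"
    using largest_inner_set[OF \<eta>, of "?\<Omega> - X"] by blast
  define R where "R = ?\<Omega> - (Z0 \<union> Z1)"
  have R: "R \<in> definable L U n M" using Z0(1) Z1(1) by (auto simp: R_def)
  have "\<mu> Z0 \<le> \<mu> X - \<epsilon>" using far Z0(1,2) by force
  moreover have "\<mu> Z1 \<le> \<mu> (?\<Omega> - X)"
    using Z1(2) over_A[OF Z1(1)] X by (intro measure_mono_on_M) auto
  moreover have "\<mu> (Z0 \<union> Z1) \<le> \<mu> Z0 + \<mu> Z1"
    using m_modular[OF over_A[OF Z0(1)] over_A[OF Z1(1)]]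
      nonneg[of "Z0 \<inter> Z1"] over_A[OF Z0(1)] over_A[OF Z1(1)] by force
  moreover have "\<mu> R = 1 - \<mu> (Z0 \<union> Z1)"
    unfolding R_def using over_A[OF Z0(1)] over_A[OF Z1(1)] by (intro m_compl) auto
  ultimately have "\<epsilon> \<le> \<mu> R" using m_compl[OF X] by linarith
  have split: "W \<inter> tuples M n \<inter> X \<noteq> {} \<and> W \<inter> tuples M n - X \<noteq> {}"
    if W: "W \<in> definable L U n M" "W \<subseteq> R" "\<epsilon> / (2 * card I) \<le> \<mu> W" for W
  proof -
    have "\<mu> (W \<union> Z0) = \<mu> W + \<mu> Z0" "\<mu> (W \<union> Z1) = \<mu> W + \<mu> Z1"
      using over_A[OF W(1)] over_A[OF Z0(1)] over_A[OF Z1(1)] W(2)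
      by (auto simp: R_def intro!: additive)
    then have "\<not> (W \<union> Z0) \<inter> tuples M n \<subseteq> X" "\<not> (W \<union> Z1) \<inter> tuples M n \<subseteq> ?\<Omega> - X"
      using Z0(3)[of "W \<union> Z0"] Z1(3)[of "W \<union> Z1"] Z0(1) Z1(1) W(1,3) unfolding \<eta>_def by force+
    then show ?thesis using Z0(2) Z1(2) W(2) unfolding R_def by blast
  qed
  define \<Psi> where "\<Psi> S = tuples (univ U) (K * n) - realize_pattern U Y n k K S" for S
  have \<Psi>: "\<Psi> S \<in> definable L U (K * n) M" for S
    unfolding \<Psi>_def
    using definable_realize_pattern[OF definable_mono[OF empty_subsetI Y] M_U] by blast
  have cover: "\<exists>S \<in> I. z \<in> \<Psi> S" if "z \<in> tuples M (K * n)" for z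
    using K tuples_mono[OF M_U that] unfolding I_def \<Psi>_def shattered_blocks_def by blast
  obtain S z where z: "S \<in> I" "z \<in> tuples M (K * n)" "z \<in> \<Psi> S" "\<forall>i < K. block n i z \<in> X \<longleftrightarrow> i \<in> S"
    using prescribed_signs[OF I R \<open>\<epsilon> \<le> \<mu> R\<close> \<open>0 < \<epsilon>\<close> split \<Psi> cover, where \<tau> = "\<lambda>S i. i \<in> S"] by blast
  have "block n i z @ d \<in> Y \<longleftrightarrow> i \<in> S" if "i < K" for i
  proof -
    have "block n i z \<in> X \<longleftrightarrow> i \<in> S" using z(4) that by blast
    then show ?thesis using block_in_tuples[OF that tuples_mono[OF M_U z(2)]] by (simp add: XY)
  qed
  then have "z \<in> realize_pattern U Y n k K S"
    unfolding realize_pattern_def using tuples_mono[OF M_U z(2)] tuples_mono[OF A_U d] by blast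
  then show False using z(3) by (simp add: \<Psi>_def)
qed

text \<open>
  The approximating sets over \<open>A\<close> are replaced by sets over \<open>M\<close>.  That one of the finitely many
  resulting pairs encloses the fibre is a property of the parameter, definable over \<open>M\<close>; it holds for
  all parameters in \<open>M\<close>, hence for all parameters in \<open>U\<close>.
\<close>

lemma sandwich_over_submodel:
  assumes NIP: "\<And>k Y. Y \<in> definable L U (n + k) {} \<Longrightarrow> \<exists>K. shattered_blocks U Y n k K = {}"
    and X: "X \<in> definable L U n (univ U)" and "0 < \<epsilon>"
  shows "\<exists>Z0 \<in> definable L U n M. \<exists>Z1 \<in> definable L U n M. Z0 \<subseteq> X \<and> X \<subseteq> Z1 \<and> \<mu> Z1 - \<mu> Z0 < \<epsilon>"
proof -
  obtain k d Y where d: "d \<in> tuples (univ U) k" and Y: "Y \<in> definable L U (n + k) {}"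
    and "X = {a \<in> tuples (univ U) n. a @ d \<in> Y}"
    using definable_parameters[OF X order_refl] .
  then have XY: "X = fibre U n Y d" by (simp add: fibre_def)
  let ?\<Omega> = "tuples (univ U) n"
  have \<epsilon>3: "0 < \<epsilon> / 3" using \<open>0 < \<epsilon>\<close> by simp
  obtain \<Theta> where \<Theta>: "finite \<Theta>"
      "\<forall>(X0, X1) \<in> \<Theta>. X0 \<in> definable L U n A \<and> X1 \<in> definable L U n A \<and> \<mu> X1 - \<mu> X0 < \<epsilon> / 3"
      "\<forall>b \<in> tuples (univ U) k. \<exists>(X0, X1) \<in> \<Theta>.
         X0 \<inter> tuples M n \<subseteq> fibre U n Y b \<and> fibre U n Y b \<inter> tuples M n \<subseteq> X1"
    using sandwich[OF Y \<epsilon>3] by blast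
  have inner: "\<exists>Z \<in> definable L U n M. Z \<inter> tuples M n \<subseteq> V \<and> \<mu> V - \<mu> Z < \<epsilon> / 3"
    if "V \<in> definable L U n A" for V
    by (rule inner_approximation[OF NIP that \<epsilon>3])
  have outer: "\<exists>Z \<in> definable L U n M. V \<inter> tuples M n \<subseteq> Z \<and> \<mu> Z - \<mu> V < \<epsilon> / 3"
    if V: "V \<in> definable L U n A" for V
  proof -
    obtain Z where Z: "Z \<in> definable L U n M" "Z \<inter> tuples M n \<subseteq> ?\<Omega> - V" "\<mu> (?\<Omega> - V) - \<mu> Z < \<epsilon> / 3"
      using inner[of "?\<Omega> - V"] V by auto
    have "V \<inter> tuples M n \<subseteq> ?\<Omega> - Z" using Z(2) tuples_mono[OF M_U] by blast
    moreover have "\<mu> (?\<Omega> - Z) - \<mu> V < \<epsilon> / 3" using m_compl[OF V] m_compl[OF over_A[OF Z(1)]] Z(3) by simp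
    ultimately show ?thesis using Z(1) by blast
  qed
  obtain f where f: "\<And>V. V \<in> definable L U n A \<Longrightarrow>
      f V \<in> definable L U n M \<and> f V \<inter> tuples M n \<subseteq> V \<and> \<mu> V - \<mu> (f V) < \<epsilon> / 3"
    using inner by metis
  obtain g where g: "\<And>V. V \<in> definable L U n A \<Longrightarrow>
      g V \<in> definable L U n M \<and> V \<inter> tuples M n \<subseteq> g V \<and> \<mu> (g V) - \<mu> V < \<epsilon> / 3"
    using outer by metis
  \<comment> \<open>The parameters \<open>b\<close> whose fibre fails to be enclosed between \<open>f X0\<close> and \<open>g X1\<close>.\<close>
  define bad where "bad X0 X1 = {b \<in> tuples (univ U) k. \<exists>a \<in> ?\<Omega>. a @ b \<in>
    ({as \<in> tuples (univ U) (n + k). take n as \<in> f X0} - Y) \<union>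
    (Y - {as \<in> tuples (univ U) (n + k). take n as \<in> g X1})}" for X0 X1
  have bad: "bad X0 X1 \<in> definable L U k M" if "X0 \<in> definable L U n A" "X1 \<in> definable L U n A" for X0 X1
    unfolding bad_def
    using f[OF that(1)] g[OF that(2)] definable_mono[OF empty_subsetI Y]
    by (intro definable_projection_front[OF _ M_U] definable.Un definable.Diff definable_cylinder M_U) auto
  have bad_iff: "b \<in> bad X0 X1 \<longleftrightarrow> \<not> (f X0 \<subseteq> fibre U n Y b \<and> fibre U n Y b \<subseteq> g X1)"
    if "X0 \<in> definable L U n A" "X1 \<in> definable L U n A" "b \<in> tuples (univ U) k" for X0 X1 b
  proof -
    have "f X0 \<subseteq> ?\<Omega>" using f[OF that(1)] definable.sets_into_space by blast
    moreover have "take n (a @ b) = a" "a @ b \<in> tuples (univ U) (n + k)" if "a \<in> ?\<Omega>" for a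
      using that tuples_append[OF that \<open>b \<in> tuples (univ U) k\<close>] by (simp_all add: tuples_def)
    ultimately show ?thesis using that(3) unfolding bad_def fibre_def by auto
  qed
  define B where "B = {b \<in> tuples (univ U) k. \<forall>\<theta> \<in> \<Theta>. b \<in> bad (fst \<theta>) (snd \<theta>)}"
  have "B \<in> definable L U k M"
  proof -
    have "{b \<in> tuples (univ U) k. b \<in> bad (fst \<theta>) (snd \<theta>)} \<in> definable L U k M" if "\<theta> \<in> \<Theta>" for \<theta>
    proof -
      have "bad (fst \<theta>) (snd \<theta>) \<in> definable L U k M" using \<Theta>(2) that by (intro bad) auto
      moreover have "{b \<in> tuples (univ U) k. b \<in> bad (fst \<theta>) (snd \<theta>)} = bad (fst \<theta>) (snd \<theta>)"
        by (auto simp: bad_def)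
      ultimately show ?thesis by simp
    qed
    then show ?thesis unfolding B_def by (intro definable_Ball \<Theta>(1))
  qed
  moreover have "B \<inter> tuples M k = {}"
  proof (rule ccontr)
    assume "B \<inter> tuples M k \<noteq> {}"
    then obtain b where b: "b \<in> tuples M k" "b \<in> B" by blast
    have bU: "b \<in> tuples (univ U) k" by (rule tuples_mono[OF M_U b(1)])
    then obtain X0 X1 where X: "(X0, X1) \<in> \<Theta>" "X0 \<inter> tuples M n \<subseteq> fibre U n Y b"
        "fibre U n Y b \<inter> tuples M n \<subseteq> X1" using \<Theta>(3) by blast
    then have def: "X0 \<in> definable L U n A" "X1 \<in> definable L U n A" using \<Theta>(2) by auto
    have F: "fibre U n Y b \<in> definable L U n M"
      by (rule definable_fibre[OF definable_mono[OF empty_subsetI Y] M_U b(1)])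
    have "(f X0 - fibre U n Y b) \<inter> tuples M n = {}" "(fibre U n Y b - g X1) \<inter> tuples M n = {}"
      using X(2,3) f[OF def(1)] g[OF def(2)] by blast+
    then have "f X0 \<subseteq> fibre U n Y b" "fibre U n Y b \<subseteq> g X1"
      using tarski_vaught[of "f X0 - fibre U n Y b"] tarski_vaught[of "fibre U n Y b - g X1"]
        F f[OF def(1)] g[OF def(2)] by blast+
    moreover have "b \<in> bad X0 X1" using b(2) X(1) unfolding B_def by force
    ultimately show False using bad_iff[OF def bU] by blast
  qed
  ultimately have "B = {}" using tarski_vaught by blast
  then obtain X0 X1 where X: "(X0, X1) \<in> \<Theta>" "d \<notin> bad X0 X1" using d unfolding B_def by force
  then have def: "X0 \<in> definable L U n A" "X1 \<in> definable L U n A" "\<mu> X1 - \<mu> X0 < \<epsilon> / 3" using \<Theta>(2) by auto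
  have "f X0 \<subseteq> X" "X \<subseteq> g X1" using bad_iff[OF def(1,2) d] X(2) XY by auto
  moreover have "\<mu> (g X1) - \<mu> (f X0) < \<epsilon>" using f[OF def(1)] g[OF def(2)] def(3) by linarith
  ultimately show ?thesis using f[OF def(1)] g[OF def(2)] by blast
qed

end

section \<open>Measures on formulas\<close>

lemma charge_of_fa_measure:
  assumes "fa_measure N n F \<mu>" "bool_closed F"
  shows "\<exists>q. charge (tuples (univ N) n) (solutions N n ` F) q \<and>
    (\<forall>\<phi> \<in> F. q (solutions N n \<phi>) = \<mu> \<phi>)"
proof -
  have cong: "\<mu> \<phi> = \<mu> \<psi>" if "\<phi> \<in> F" "\<psi> \<in> F" "solutions N n \<phi> = solutions N n \<psi>" for \<phi> \<psi>
    using assms(1) that unfolding fa_measure_def by metis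
  have nonneg: "0 \<le> \<mu> \<phi>" if "\<phi> \<in> F" for \<phi> using assms(1) that unfolding fa_measure_def by metis
  define q where "q X = \<mu> (SOME \<phi>. \<phi> \<in> F \<and> solutions N n \<phi> = X)" for X
  have q: "q (solutions N n \<phi>) = \<mu> \<phi>" if "\<phi> \<in> F" for \<phi>
  proof -
    let ?\<psi> = "SOME \<psi>. \<psi> \<in> F \<and> solutions N n \<psi> = solutions N n \<phi>"
    have "?\<psi> \<in> F \<and> solutions N n ?\<psi> = solutions N n \<phi>"
      by (rule someI[of _ \<phi>]) (use that in simp)
    then show ?thesis unfolding q_def using that by (intro cong) simp_all
  qed
  have bool: "Tru \<in> F" "\<And>\<phi>. \<phi> \<in> F \<Longrightarrow> Neg \<phi> \<in> F" "\<And>\<phi> \<psi>. \<phi> \<in> F \<Longrightarrow> \<psi> \<in> F \<Longrightarrow> Conj \<phi> \<psi> \<in> F"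
    using assms(2) by (auto simp: bool_closed_def)
  have "algebra (tuples (univ N) n) (solutions N n ` F)"
    unfolding algebra_iff_Int
  proof (intro conjI ballI)
    show "solutions N n ` F \<subseteq> Pow (tuples (univ N) n)" using solutions_subset by auto
    have "{} = solutions N n (Neg Tru)" by simp
    then show "{} \<in> solutions N n ` F" using bool by blast
  next
    fix X assume "X \<in> solutions N n ` F"
    then obtain \<phi> where "\<phi> \<in> F" "X = solutions N n \<phi>" by blast
    then have "tuples (univ N) n - X = solutions N n (Neg \<phi>)" "Neg \<phi> \<in> F" using bool by auto
    then show "tuples (univ N) n - X \<in> solutions N n ` F" by blast
  next
    fix X Y assume "X \<in> solutions N n ` F" "Y \<in> solutions N n ` F"
    then obtain \<phi> \<psi> where "\<phi> \<in> F" "X = solutions N n \<phi>" "\<psi> \<in> F" "Y = solutions N n \<psi>" by blast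
    then have "X \<inter> Y = solutions N n (Conj \<phi> \<psi>)" "Conj \<phi> \<psi> \<in> F" using bool by auto
    then show "X \<inter> Y \<in> solutions N n ` F" by blast
  qed
  moreover have "0 \<le> q X" if "X \<in> solutions N n ` F" for X
    using that q nonneg by auto
  moreover have "q (tuples (univ N) n) = 1"
    using q[OF bool(1)] assms(1) by (simp add: fa_measure_def)
  moreover have "q (X \<union> Y) = q X + q Y"
    if XY: "X \<in> solutions N n ` F" "Y \<in> solutions N n ` F" "X \<inter> Y = {}" for X Y
  proof -
    obtain \<phi> \<psi> where \<phi>: "\<phi> \<in> F" "X = solutions N n \<phi>" "\<psi> \<in> F" "Y = solutions N n \<psi>" using XY by blast
    have "X \<union> Y = solutions N n (Disj \<phi> \<psi>)"
      using \<phi>(2,4) solutions_subset[of N n \<phi>] solutions_subset[of N n \<psi>] by auto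
    then have "q (X \<union> Y) = \<mu> (Disj \<phi> \<psi>)" using q bool \<phi>(1,3) by metis
    also have "\<dots> = \<mu> \<phi> + \<mu> \<psi>"
      using assms(1) \<phi> XY(3) unfolding fa_measure_def by metis
    finally show ?thesis using q \<phi> by simp
  qed
  ultimately have "charge (tuples (univ N) n) (solutions N n ` F) q"
    by (intro charge.intro charge_axioms.intro)
  then show ?thesis using q by blast
qed

lemma fa_measure_of_charge:
  assumes "charge (tuples (univ N) n) (Pow (tuples (univ N) n)) q"
  shows "fa_measure N n F (\<lambda>\<phi>. q (solutions N n \<phi>))"
  unfolding fa_measure_def
proof (intro conjI ballI impI)
  have in_Pow: "solutions N n \<phi> \<in> Pow (tuples (univ N) n)" for \<phi> using solutions_subset by blast
  show "0 \<le> q (solutions N n \<phi>)" for \<phi> by (rule charge.nonneg[OF assms in_Pow])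
  show "q (solutions N n Tru) = 1" using charge.total[OF assms] by simp
  fix \<phi> \<psi> assume disj: "solutions N n \<phi> \<inter> solutions N n \<psi> = {}"
  have "solutions N n (Disj \<phi> \<psi>) = solutions N n \<phi> \<union> solutions N n \<psi>"
    using in_Pow[of \<phi>] in_Pow[of \<psi>] by auto
  then show "q (solutions N n (Disj \<phi> \<psi>)) = q (solutions N n \<phi>) + q (solutions N n \<psi>)"
    using charge.additive[OF assms in_Pow in_Pow disj] by (simp only:)
qed (simp only:)

lemma fa_measure_mono:
  assumes "fa_measure N n F \<mu>" "bool_closed F" "\<phi> \<in> F" "\<psi> \<in> F" "solutions N n \<phi> \<subseteq> solutions N n \<psi>"
  shows "\<mu> \<phi> \<le> \<mu> \<psi>"
proof -
  obtain q where "charge (tuples (univ N) n) (solutions N n ` F) q"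
    "\<And>\<phi>. \<phi> \<in> F \<Longrightarrow> q (solutions N n \<phi>) = \<mu> \<phi>"
    using charge_of_fa_measure[OF assms(1,2)] by blast
  then show ?thesis using charge.m_mono[of _ _ q "solutions N n \<phi>" "solutions N n \<psi>"] assms(3-5) by auto
qed

lemma unique_extension_sandwich:
  assumes \<mu>: "fa_measure N n F \<mu>" "bool_closed F"
    and unique: "unique_extension N n F G \<mu>" and \<phi>: "\<phi> \<in> G" and "0 < \<epsilon>"
  shows "\<exists>\<alpha> \<in> F. \<exists>\<beta> \<in> F. solutions N n \<alpha> \<subseteq> solutions N n \<phi> \<and>
    solutions N n \<phi> \<subseteq> solutions N n \<beta> \<and> \<mu> \<beta> - \<mu> \<alpha> < \<epsilon>"
proof -
  obtain p where p: "charge (tuples (univ N) n) (solutions N n ` F) p"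
    and p\<mu>: "\<And>\<phi>. \<phi> \<in> F \<Longrightarrow> p (solutions N n \<phi>) = \<mu> \<phi>"
    using charge_of_fa_measure[OF \<mu>] by blast
  have eq: "\<nu> \<phi> = \<nu>' \<phi>"
    if "fa_measure N n G \<nu>" "\<forall>\<phi> \<in> F. \<nu> \<phi> = \<mu> \<phi>" "fa_measure N n G \<nu>'" "\<forall>\<phi> \<in> F. \<nu>' \<phi> = \<mu> \<phi>" for \<nu> \<nu>'
    by (rule unique[unfolded unique_extension_def, THEN conjunct2, rule_format, OF _ \<phi>]) (intro conjI that)
  have "\<exists>X \<in> solutions N n ` F. \<exists>Y \<in> solutions N n ` F. X \<subseteq> solutions N n \<phi> \<and>
      solutions N n \<phi> \<subseteq> Y \<and> p Y - p X < \<epsilon>"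
  proof (rule charge.sandwich_if_unique_extension[OF p solutions_subset \<open>0 < \<epsilon>\<close>])
    fix q r
    assume q: "charge (tuples (univ N) n) (Pow (tuples (univ N) n)) q"
      and r: "charge (tuples (univ N) n) (Pow (tuples (univ N) n)) r"
      and qp: "\<And>X. X \<in> solutions N n ` F \<Longrightarrow> q X = p X"
      and rp: "\<And>X. X \<in> solutions N n ` F \<Longrightarrow> r X = p X"
    have "\<forall>\<psi> \<in> F. q (solutions N n \<psi>) = \<mu> \<psi>" "\<forall>\<psi> \<in> F. r (solutions N n \<psi>) = \<mu> \<psi>"
      using qp rp p\<mu> by auto
    then show "q (solutions N n \<phi>) = r (solutions N n \<phi>)"
      by (rule eq[OF fa_measure_of_charge[OF q] _ fa_measure_of_charge[OF r]])
  qed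
  then show ?thesis using p\<mu> by auto
qed

section \<open>Pairs of models\<close>

lemma elementary_sub_trans:
  assumes "elementary_sub L M N" "elementary_sub L N K"
  shows "elementary_sub L M K"
proof -
  have "formulas L 0 (univ M) \<subseteq> formulas L 0 (univ N)"
    using assms(1) fm_ok_mono unfolding elementary_sub_def formulas_def by blast
  then show ?thesis using assms unfolding elementary_sub_def by blast
qed

lemma predicate_subset_if_elementary_sub:
  assumes "elementary_sub (add_pred L) (pair M' P) (pair U PU)" "P \<subseteq> univ M'"
  shows "P \<subseteq> PU"
proof
  fix a assume "a \<in> P"
  let ?\<sigma> = "Rel None [Cst a]"
  have "?\<sigma> \<in> formulas (add_pred L) 0 (univ (pair M' P))"
    using assms(2) \<open>a \<in> P\<close> by (auto simp: formulas_def add_pred_def)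
  then have "holds (pair M' P) ?\<sigma> [] \<longleftrightarrow> holds (pair U PU) ?\<sigma> []"
    using assms(1) unfolding elementary_sub_def by blast
  then show "a \<in> PU" using \<open>a \<in> P\<close> by (simp add: holds_def pair_def)
qed

lemma fv_lift: "fv (lift \<phi>) = fv \<phi>"
  by (induction \<phi>) (auto simp: lift_def trm.map_ident)

lemma fm_ok_lift:
  fixes L :: "('f, 'r) lang" and \<phi> :: "('f, 'r, 'a) fm"
  shows "fm_ok L A \<phi> \<Longrightarrow> fm_ok (add_pred L) A (lift \<phi>)"
proof -
  have trm: "trm_ok L A t \<Longrightarrow> trm_ok (add_pred L) A t" for t :: "('f, 'a) trm"
    by (induction t) (auto simp: list_all_iff add_pred_def)
  show "fm_ok L A \<phi> \<Longrightarrow> fm_ok (add_pred L) A (lift \<phi>)"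
    by (induction \<phi>) (auto simp: lift_def trm.map_ident list_all_iff trm, auto simp: add_pred_def)
qed

lemma definable_pair:
  assumes "X \<in> definable L U k A"
  shows "X \<in> definable (add_pred L) (pair U PU) k A"
proof -
  obtain \<phi> where "\<phi> \<in> formulas L k A" "X = solutions (pair U PU) k (lift \<phi>)"
    using assms by (auto simp: definable_def)
  moreover from this have "lift \<phi> \<in> formulas (add_pred L) k A"
    by (simp add: formulas_def fv_lift fm_ok_lift)
  ultimately show ?thesis using solutions_definable by metis
qed

lemma tuples_predicate_definable:
  fixes L :: "('f, 'r) lang" and U :: "('a, 'f, 'r) struct"
  assumes "PU \<subseteq> univ U"
  shows "tuples PU n \<in> definable (add_pred L) (pair U PU) n A"
proof -
  have "fm_ok (add_pred L) A (P_all n) \<and> fv (P_all n :: ('f, 'r option, 'a) fm) \<subseteq> {..<n}"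
    by (induction n) (auto simp: add_pred_def)
  then have "P_all n \<in> formulas (add_pred L) n A" by (simp add: formulas_def)
  from solutions_definable[OF this] solutions_P_all[OF assms] show ?thesis by metis
qed

text \<open>
  If no finite set of pairs worked, saturation of the pair of models would provide parameters \<open>b\<close> for
  which no pair at all works, while smoothness gives one for each single \<open>b\<close>.  The approximating formulas of \<open>\<Delta>\<close> become formulas of \<open>L\<close> on \<open>P\<close>, which has measure 1; this is why
  the inclusions only hold on \<open>P\<close>.
\<close>

lemma uniform_sandwich_on_predicate:
  assumes tilde: "is_tilde L U PU n A \<mu> \<mu>t" and smooth: "Delta_smooth L U PU n A \<mu>t"
    and PU: "PU \<subseteq> univ U" and A: "A \<subseteq> univ U"
    and sat: "saturated \<kappa> (add_pred L) (pair U PU)" "|A| <o \<kappa>"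
    and q: "\<And>\<phi>. \<phi> \<in> formulas L n A \<Longrightarrow> q (solutions U n \<phi>) = \<mu> \<phi>"
    and Y: "Y \<in> definable L U (n + k) {}" and "0 < \<epsilon>"
  shows "\<exists>\<Theta>. finite \<Theta> \<and>
      (\<forall>(X0, X1) \<in> \<Theta>. X0 \<in> definable L U n A \<and> X1 \<in> definable L U n A \<and> q X1 - q X0 < \<epsilon>) \<and>
      (\<forall>b \<in> tuples (univ U) k. \<exists>(X0, X1) \<in> \<Theta>.
         X0 \<inter> tuples PU n \<subseteq> fibre U n Y b \<and> fibre U n Y b \<inter> tuples PU n \<subseteq> X1)"
proof (rule ccontr)
  assume none: "\<not> ?thesis"
  let ?LP = "add_pred L" and ?W = "pair U PU"
  define \<P> where "\<P> = {(X0, X1). X0 \<in> definable L U n A \<and> X1 \<in> definable L U n A \<and> q X1 - q X0 < \<epsilon>}"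
  define bad where "bad \<theta> = {b \<in> tuples (univ ?W) k. \<exists>a \<in> tuples (univ ?W) n. a @ b \<in>
    {as \<in> tuples (univ ?W) (n + k). take n as \<in> tuples PU n} \<inter>
    (({as \<in> tuples (univ ?W) (n + k). take n as \<in> fst \<theta>} - Y) \<union>
    (Y - {as \<in> tuples (univ ?W) (n + k). take n as \<in> snd \<theta>}))}" for \<theta>
  have bad_iff: "b \<in> bad \<theta> \<longleftrightarrow>
      \<not> (fst \<theta> \<inter> tuples PU n \<subseteq> fibre U n Y b \<and> fibre U n Y b \<inter> tuples PU n \<subseteq> snd \<theta>)"
    if b: "b \<in> tuples (univ U) k" for b \<theta>
  proof -
    have "take n (a @ b) = a" "a @ b \<in> tuples (univ U) (n + k)" if "a \<in> tuples (univ U) n" for a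
      using that tuples_append[OF that b] by (simp_all add: tuples_def)
    moreover have "a \<in> tuples (univ U) n" if "a \<in> tuples PU n" for a by (rule tuples_mono[OF PU that])
    ultimately show ?thesis using b unfolding bad_def fibre_def by auto
  qed
  have A': "A \<subseteq> univ ?W" using A by simp
  have "bad \<theta> \<in> definable ?LP ?W k A" if "\<theta> \<in> \<P>" for \<theta>
  proof -
    have "fst \<theta> \<in> definable ?LP ?W n A" "snd \<theta> \<in> definable ?LP ?W n A"
      using that by (auto simp: \<P>_def intro!: definable_pair)
    moreover have "Y \<in> definable ?LP ?W (n + k) A"
      by (rule definable_pair[OF definable_mono[OF empty_subsetI Y]])
    ultimately show ?thesis
      unfolding bad_def using tuples_predicate_definable[OF PU]
      by (intro definable_projection_front[OF _ A'] definable.Int definable.Un definable.Diff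
          definable_cylinder[OF _ A'])
  qed
  then have "bad ` \<P> \<subseteq> definable ?LP ?W k A" by blast
  moreover have "\<exists>b \<in> tuples (univ ?W) k. \<forall>X \<in> \<G>. b \<in> X" if \<G>: "finite \<G>" "\<G> \<subseteq> bad ` \<P>" for \<G>
  proof -
    obtain \<Theta> where \<Theta>: "finite \<Theta>" "\<Theta> \<subseteq> \<P>" "\<G> = bad ` \<Theta>" using finite_subset_image[OF \<G>] by blast
    have "\<forall>(X0, X1) \<in> \<Theta>. X0 \<in> definable L U n A \<and> X1 \<in> definable L U n A \<and> q X1 - q X0 < \<epsilon>"
      using \<Theta>(2) unfolding \<P>_def by blast
    then have "\<not> (\<forall>b \<in> tuples (univ U) k. \<exists>(X0, X1) \<in> \<Theta>.
         X0 \<inter> tuples PU n \<subseteq> fibre U n Y b \<and> fibre U n Y b \<inter> tuples PU n \<subseteq> X1)"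
      using none \<Theta>(1) by blast
    then obtain b where b: "b \<in> tuples (univ U) k" "\<not> (\<exists>(X0, X1) \<in> \<Theta>.
         X0 \<inter> tuples PU n \<subseteq> fibre U n Y b \<and> fibre U n Y b \<inter> tuples PU n \<subseteq> X1)" by blast
    then have "\<forall>\<theta> \<in> \<Theta>. b \<in> bad \<theta>"
      using bad_iff[OF b(1)] by (auto split: prod.splits)
    then show ?thesis using \<Theta>(3) b(1) by (intro bexI[of _ b]) auto
  qed
  ultimately obtain b where b: "b \<in> tuples (univ ?W) k" "\<And>X. X \<in> bad ` \<P> \<Longrightarrow> b \<in> X"
    using saturated_definable[OF sat(1) A' sat(2)] by metis
  have bU: "b \<in> tuples (univ U) k" using b(1) by simp
  have "fibre U n Y b \<in> definable L U n (univ U)"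
    by (rule definable_fibre[OF definable_mono[OF empty_subsetI Y] order_refl bU])
  then obtain \<phi> where \<phi>: "\<phi> \<in> formulas L n (univ U)" "fibre U n Y b = solutions U n \<phi>"
    by (auto simp: definable_def)
  have "fa_measure ?W n (Delta L n A) \<mu>t" using tilde by (simp add: is_tilde_def Delta_measure_def)
  moreover have "lift \<phi> \<in> Delta L n (univ U)" using \<phi>(1) by (rule Delta.intros)
  ultimately obtain \<alpha> \<beta> where \<alpha>\<beta>: "\<alpha> \<in> Delta L n A" "\<beta> \<in> Delta L n A"
      "solutions ?W n \<alpha> \<subseteq> solutions ?W n (lift \<phi>)" "solutions ?W n (lift \<phi>) \<subseteq> solutions ?W n \<beta>"
      "\<mu>t \<beta> - \<mu>t \<alpha> < \<epsilon>"
    using unique_extension_sandwich[OF _ bool_closed_Delta smooth[unfolded Delta_smooth_def] _ \<open>0 < \<epsilon>\<close>]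
    by blast
  obtain \<alpha>' where \<alpha>': "\<alpha>' \<in> formulas L n A"
      "solutions ?W n \<alpha> \<inter> tuples PU n = solutions U n \<alpha>' \<inter> tuples PU n"
    using Delta_on_P[OF \<alpha>\<beta>(1) PU] by blast
  obtain \<beta>' where \<beta>': "\<beta>' \<in> formulas L n A"
      "solutions ?W n \<beta> \<inter> tuples PU n = solutions U n \<beta>' \<inter> tuples PU n"
    using Delta_on_P[OF \<alpha>\<beta>(2) PU] by blast
  let ?\<theta> = "(solutions U n \<alpha>', solutions U n \<beta>')"
  have "q (solutions U n \<alpha>') = \<mu>t \<alpha>" "q (solutions U n \<beta>') = \<mu>t \<beta>"
    using is_tilde_eq[OF tilde PU \<alpha>\<beta>(1) \<alpha>'] is_tilde_eq[OF tilde PU \<alpha>\<beta>(2) \<beta>'] q \<alpha>'(1) \<beta>'(1) by auto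
  then have "?\<theta> \<in> \<P>" using \<alpha>\<beta>(5) \<alpha>'(1) \<beta>'(1) by (simp add: \<P>_def solutions_definable)
  then have "b \<in> bad ?\<theta>" using b(2) by blast
  moreover have "solutions U n \<alpha>' \<inter> tuples PU n \<subseteq> fibre U n Y b"
    "fibre U n Y b \<inter> tuples PU n \<subseteq> solutions U n \<beta>'"
    using \<alpha>\<beta>(3,4) \<alpha>'(2) \<beta>'(2) \<phi>(2) by auto
  ultimately show False using bad_iff[OF bU] by simp
qed

lemma fa_measure_restrict_lift:
  fixes U :: "('a, 'f, 'r) struct"
  assumes "fa_measure (pair U PU) n (Delta L n A) \<nu>"
  shows "fa_measure U n (formulas L n A) (\<lambda>\<phi>. \<nu> (lift \<phi>))"
proof -
  have lift: "lift Tru = Tru" "lift (Disj \<phi> \<psi>) = Disj (lift \<phi>) (lift \<psi>)" for \<phi> \<psi> :: "('f, 'r, 'a) fm"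
    by (simp_all add: lift_def)
  have "lift \<phi> \<in> Delta L n A" if "\<phi> \<in> formulas L n A" for \<phi> using that by (rule Delta.intros)
  then show ?thesis using assms unfolding fa_measure_def lift by (simp add: solutions_lift)
qed

text \<open>Two extensions differ at a formula by at most the width of any sandwich around it.\<close>

lemma unique_extension_if_sandwiched:
  assumes \<nu>: "fa_measure N n G \<nu>" "\<And>\<phi>. \<phi> \<in> F \<Longrightarrow> \<nu> \<phi> = \<mu> \<phi>"
    and G: "bool_closed G" "F \<subseteq> G"
    and sandwich: "\<And>\<phi> \<epsilon>. \<phi> \<in> G \<Longrightarrow> 0 < \<epsilon> \<Longrightarrow> \<exists>\<alpha> \<in> F. \<exists>\<beta> \<in> F.
      solutions N n \<alpha> \<subseteq> solutions N n \<phi> \<and> solutions N n \<phi> \<subseteq> solutions N n \<beta> \<and> \<mu> \<beta> - \<mu> \<alpha> < \<epsilon>"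
  shows "unique_extension N n F G \<mu>"
  unfolding unique_extension_def
proof (intro conjI allI impI ballI)
  show "\<exists>\<nu>. fa_measure N n G \<nu> \<and> (\<forall>\<phi> \<in> F. \<nu> \<phi> = \<mu> \<phi>)" using \<nu> by blast
next
  fix \<nu>1 \<nu>2 \<phi>
  assume ext: "fa_measure N n G \<nu>1 \<and> (\<forall>\<phi> \<in> F. \<nu>1 \<phi> = \<mu> \<phi>) \<and>
      fa_measure N n G \<nu>2 \<and> (\<forall>\<phi> \<in> F. \<nu>2 \<phi> = \<mu> \<phi>)" and \<phi>: "\<phi> \<in> G"
  have "\<bar>\<nu>1 \<phi> - \<nu>2 \<phi>\<bar> \<le> 0 + \<epsilon>" if \<epsilon>: "0 < \<epsilon>" for \<epsilon>
  proof -
    obtain \<alpha> \<beta> where s: "\<alpha> \<in> F" "\<beta> \<in> F" "solutions N n \<alpha> \<subseteq> solutions N n \<phi>"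
        "solutions N n \<phi> \<subseteq> solutions N n \<beta>" "\<mu> \<beta> - \<mu> \<alpha> < \<epsilon>"
      using sandwich[OF \<phi> \<epsilon>] by blast
    have "\<mu> \<alpha> \<le> \<rho> \<phi> \<and> \<rho> \<phi> \<le> \<mu> \<beta>" if "fa_measure N n G \<rho>" "\<forall>\<phi> \<in> F. \<rho> \<phi> = \<mu> \<phi>" for \<rho>
      using fa_measure_mono[OF that(1) G(1) _ \<phi> s(3)] fa_measure_mono[OF that(1) G(1) \<phi> _ s(4)]
        s(1,2) G(2) that(2) by auto
    then have "\<mu> \<alpha> \<le> \<nu>1 \<phi>" "\<nu>1 \<phi> \<le> \<mu> \<beta>" "\<mu> \<alpha> \<le> \<nu>2 \<phi>" "\<nu>2 \<phi> \<le> \<mu> \<beta>" using ext by blast+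
    then show ?thesis using s(5) by linarith
  qed
  then have "\<bar>\<nu>1 \<phi> - \<nu>2 \<phi>\<bar> \<le> 0" by (rule field_le_epsilon)
  then show "\<nu>1 \<phi> = \<nu>2 \<phi>" by simp
qed

section \<open>Smoothness over the submodel\<close>

theorem theorem4p4:
  fixes L :: "('f, 'r) lang"
    and T :: "('f, 'r, 'a) fm set"
    and \<kappa> :: "'k rel"
    and U M' M :: "('a, 'f, 'r) struct"
    and PU :: "'a set"
    and n :: nat
    and \<mu> :: "('f, 'r, 'a) fm \<Rightarrow> real"
    and \<mu>t :: "('f, 'r option, 'a) fm \<Rightarrow> real"
  assumes "complete_theory L T"
    and "NIP L T"
    and "is_model L T U" and "monster \<kappa> L U"
    and "is_model L T M'" and "elementary_sub L M' U" and "|univ M'| <o \<kappa>"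
    and "elementary_sub L M M'"
    and "PU \<subseteq> univ U"
    and "elementary_sub (add_pred L) (pair M' (univ M)) (pair U PU)"
    and "monster \<kappa> (add_pred L) (pair U PU)"
    and "L_measure L U n (univ M') \<mu>"
    and "fin_satisfiable L U n (univ M') \<mu> (univ M)"
    and "is_tilde L U PU n (univ M') \<mu> \<mu>t"
    and "Delta_smooth L U PU n (univ M') \<mu>t"
  shows "L_smooth L U n (univ M) \<mu>"
proof -
  note NIP = assms(2) and U = assms(3,4) and PU = assms(9)
  have M'U: "univ M' \<subseteq> univ U" using assms(6) by (simp add: elementary_sub_def)
  have MM': "univ M \<subseteq> univ M'" using assms(8) by (simp add: elementary_sub_def)
  have MU: "elementary_sub L M U" by (rule elementary_sub_trans[OF assms(8,6)])
  have MPU: "univ M \<subseteq> PU" by (rule predicate_subset_if_elementary_sub[OF assms(10) MM'])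
  have sat: "saturated \<kappa> L U" "natLeq <o \<kappa>" using U(2) by (simp_all add: monster_def)
  have satP: "saturated \<kappa> (add_pred L) (pair U PU)" using assms(11) by (simp add: monster_def)
  obtain q where q: "charge (tuples (univ U) n) (solutions U n ` formulas L n (univ M')) q"
    and q\<mu>: "\<And>\<phi>. \<phi> \<in> formulas L n (univ M') \<Longrightarrow> q (solutions U n \<phi>) = \<mu> \<phi>"
    using charge_of_fa_measure[OF assms(12)[unfolded L_measure_def] bool_closed_formulas] by blast
  have fs: "finitely_satisfied_charge L U n (univ M') q (univ M)"
  proof (intro finitely_satisfied_charge.intro finitely_satisfied_charge_axioms.intro)
    show "charge (tuples (univ U) n) (definable L U n (univ M')) q"
      using q by (simp add: definable_def)
    show "X \<inter> tuples (univ M) k \<noteq> {}" if "X \<in> definable L U k (univ M)" "X \<noteq> {}" for X k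
      by (rule elementary_sub_definable[OF MU that])
    show "X \<inter> tuples (univ M) n \<noteq> {}" if X: "X \<in> definable L U n (univ M')" "0 < q X" for X
    proof -
      obtain \<phi> where \<phi>: "\<phi> \<in> formulas L n (univ M')" "X = solutions U n \<phi>"
        using X(1) by (auto simp: definable_def)
      then obtain as where "as \<in> tuples (univ M) n" "holds U \<phi> as"
        using assms(13) X(2) q\<mu> unfolding fin_satisfiable_def by auto
      then show ?thesis
        using \<phi>(2) tuples_mono[of "univ M" "univ U"] MM' M'U by (auto simp: solutions_def)
    qed
  qed (fact MM' M'U)+
  interpret uniformly_sandwiched_charge L U n "univ M'" q "univ M"
  proof (intro uniformly_sandwiched_charge.intro fs uniformly_sandwiched_charge_axioms.intro)
    fix Y k and \<epsilon> :: real
    assume Y: "Y \<in> definable L U (n + k) {}" "0 < \<epsilon>"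
    let ?ok = "\<lambda>\<Theta>. finite \<Theta> \<and> (\<forall>(X0, X1) \<in> \<Theta>. X0 \<in> definable L U n (univ M') \<and>
      X1 \<in> definable L U n (univ M') \<and> q X1 - q X0 < \<epsilon>)"
    let ?enclosed = "\<lambda>P \<Theta>. \<forall>b \<in> tuples (univ U) k. \<exists>(X0, X1) \<in> \<Theta>.
      X0 \<inter> tuples P n \<subseteq> fibre U n Y b \<and> fibre U n Y b \<inter> tuples P n \<subseteq> X1"
    have "\<exists>\<Theta>. finite \<Theta> \<and> (\<forall>(X0, X1) \<in> \<Theta>. X0 \<in> definable L U n (univ M') \<and>
      X1 \<in> definable L U n (univ M') \<and> q X1 - q X0 < \<epsilon>) \<and> ?enclosed PU \<Theta>"
      by (rule uniform_sandwich_on_predicate[OF assms(14,15) PU M'U satP assms(7) q\<mu> Y])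
    then obtain \<Theta> where \<Theta>: "?ok \<Theta>" "?enclosed PU \<Theta>" by blast
    have "tuples (univ M) n \<subseteq> tuples PU n" using tuples_mono[OF MPU] by blast
    have "?enclosed (univ M) \<Theta>"
    proof
      fix b assume "b \<in> tuples (univ U) k"
      then obtain X0 X1 where "(X0, X1) \<in> \<Theta>" "X0 \<inter> tuples PU n \<subseteq> fibre U n Y b"
          "fibre U n Y b \<inter> tuples PU n \<subseteq> X1" using \<Theta>(2) by blast
      then show "\<exists>(X0, X1) \<in> \<Theta>. X0 \<inter> tuples (univ M) n \<subseteq> fibre U n Y b \<and>
          fibre U n Y b \<inter> tuples (univ M) n \<subseteq> X1"
        using \<open>tuples (univ M) n \<subseteq> tuples PU n\<close> by (intro bexI[of _ "(X0, X1)"]) auto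
    qed
    then show "\<exists>\<Theta>. finite \<Theta> \<and> (\<forall>(X0, X1) \<in> \<Theta>. X0 \<in> definable L U n (univ M') \<and>
      X1 \<in> definable L U n (univ M') \<and> q X1 - q X0 < \<epsilon>) \<and> ?enclosed (univ M) \<Theta>"
      using \<Theta>(1) by blast
  qed
  have sub: "formulas L n (univ M) \<subseteq> formulas L n (univ M')" "formulas L n (univ M) \<subseteq> formulas L n (univ U)"
    using fm_ok_mono MM' M'U unfolding formulas_def by blast+
  obtain \<nu> where \<nu>: "fa_measure (pair U PU) n (Delta L n (univ U)) \<nu>"
      "\<And>\<theta>. \<theta> \<in> Delta L n (univ M') \<Longrightarrow> \<nu> \<theta> = \<mu>t \<theta>"
    using assms(15) unfolding Delta_smooth_def unique_extension_def by blast
  show ?thesis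
    unfolding L_smooth_def
  proof (rule unique_extension_if_sandwiched[OF fa_measure_restrict_lift[OF \<nu>(1)] _ bool_closed_formulas sub(2)])
    fix \<phi> assume "\<phi> \<in> formulas L n (univ M)"
    then have \<phi>: "\<phi> \<in> formulas L n (univ M')" using sub(1) by blast
    then have "\<nu> (lift \<phi>) = \<mu>t (lift \<phi>)" by (intro \<nu>(2) Delta.intros)
    then show "\<nu> (lift \<phi>) = \<mu> \<phi>" using assms(14) \<phi> by (simp add: is_tilde_def)
  next
    fix \<phi> and \<epsilon> :: real
    assume \<phi>: "\<phi> \<in> formulas L n (univ U)" and \<epsilon>: "0 < \<epsilon>"
    obtain Z0 Z1 where Z: "Z0 \<in> definable L U n (univ M)" "Z1 \<in> definable L U n (univ M)"
        "Z0 \<subseteq> solutions U n \<phi>" "solutions U n \<phi> \<subseteq> Z1" "q Z1 - q Z0 < \<epsilon>"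
      using sandwich_over_submodel[OF NIP_bounds_shattered_blocks[OF NIP U(1) sat]
        solutions_definable[OF \<phi>] \<epsilon>] by blast
    obtain \<alpha> \<beta> where \<alpha>\<beta>: "\<alpha> \<in> formulas L n (univ M)" "Z0 = solutions U n \<alpha>"
        "\<beta> \<in> formulas L n (univ M)" "Z1 = solutions U n \<beta>"
      using Z(1,2) by (auto simp: definable_def)
    have "q Z0 = \<mu> \<alpha>" "q Z1 = \<mu> \<beta>"
      using q\<mu>[OF subsetD[OF sub(1)]] \<alpha>\<beta> by metis+
    then have "\<mu> \<beta> - \<mu> \<alpha> < \<epsilon>" using Z(5) by simp
    then show "\<exists>\<alpha> \<in> formulas L n (univ M). \<exists>\<beta> \<in> formulas L n (univ M).
        solutions U n \<alpha> \<subseteq> solutions U n \<phi> \<and> solutions U n \<phi> \<subseteq> solutions U n \<beta> \<and> \<mu> \<beta> - \<mu> \<alpha> < \<epsilon>"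
      using Z(3,4) \<alpha>\<beta> by (intro bexI[of _ \<alpha>] bexI[of _ \<beta>]) auto
  qed
qed

end
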